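(* Let $m\ge 1$ be a fixed integer, let $\rho_n$ be an inverse-unfair permutation in $S_n$, and let $$D_{n,m}=\#\{(i,j): 1\le i,j\le n,\ 1\le j-i\le m,\ \rho_n(i)>\rho_n(j)\}$$ be the number of $m$-descents in $\rho_n$. Then for all $n\ge m$, $$\mathbb{E}[D_{n,m}]=\frac{nm}{2}-\frac{m(m+1)}{4}-\sum_{k=1}^{m}\sum_{i=1}^{n-k}\frac{k}{2(2i+k)},$$ and, as $n\to\infty$ with $m$ fixed, $$\mathrm{Var}(D_{n,m})\sim\frac{6nm+4m^3+3m^2-m}{72}.$$ Further, $$\frac{D_{n,m}-\mathbb{E}[D_{n,m}]}{\sqrt{\mathrm{Var}(D_{n,m})}}\longrightarrow_d\mathcal{G}\quad\text{as } n\to\infty,$$ where $\mathcal{G}$ is a standard normal random variable.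
   Context: $S_n$ is the symmetric group on $\{1,\dots,n\}$. Inverse-unfair permutation: let $\{X^{(i)}_j : 1\le i\le n,\ 1\le j\le i\}$ be independent random variables, each uniform on $(0,1)$, and set $Z_i=\max\{X^{(i)}_1,\dots,X^{(i)}_i\}$ for $i=1,\dots,n$. Let $R_i$ be the rank of $Z_i$ among $Z_1,\dots,Z_n$ (rank $1$ is the smallest value; ties have probability zero). Then $\rho_n=(R_1,\dots,R_n)$, i.e. $\rho_n(i)=R_i$. The notation $a_n\sim b_n$ means $\lim_{n\to\infty}a_n/b_n=1$, and $\to_d$ denotes convergence in distribution. *)

theory Defs
  imports "HOL-Probability.Probability" "HOL-Combinatorics.Permutations"
begin

locale unfair_array = prob_space M for M :: "'a measure" +
  fixes n :: nat and X :: "nat \<Rightarrow> nat \<Rightarrow> 'a \<Rightarrow> real"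
  assumes indep: "indep_vars (\<lambda>_. borel) (\<lambda>(i, j). X i j) {(i, j). 1 \<le> i \<and> i \<le> n \<and> 1 \<le> j \<and> j \<le> i}"
    and uniform: "\<And>i j. \<lbrakk>1 \<le> i; i \<le> n; 1 \<le> j; j \<le> i\<rbrakk> \<Longrightarrow>
      distr M borel (X i j) = uniform_measure lborel {0<..<1}"

definition row_max :: "(nat \<Rightarrow> nat \<Rightarrow> 'a \<Rightarrow> real) \<Rightarrow> 'a \<Rightarrow> nat \<Rightarrow> real" where
  "row_max X \<omega> i = Max ((\<lambda>j. X i j \<omega>) ` {1..i})"

(* Rank 1 is the smallest value.  Outside {1..n} the function is the identity, as the library
   notion "permutes" demands.  Ties, which form a null event for the arrays above, receive a
   common (maximal) rank. *)
definition rank_perm :: "nat \<Rightarrow> (nat \<Rightarrow> real) \<Rightarrow> nat \<Rightarrow> nat" where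
  "rank_perm n z i = (if i \<in> {1..n} then card {k \<in> {1..n}. z k \<le> z i} else i)"

lemma rank_perm_permutes:
  assumes "inj_on z {1..n}"
  shows "rank_perm n z permutes {1..n}"
proof -
  have less: "rank_perm n z i < rank_perm n z j"
    if "i \<in> {1..n}" "j \<in> {1..n}" "z i < z j" for i j
  proof -
    have "{k \<in> {1..n}. z k \<le> z i} \<subset> {k \<in> {1..n}. z k \<le> z j}"
    proof (rule psubsetI)
      show "{k \<in> {1..n}. z k \<le> z i} \<subseteq> {k \<in> {1..n}. z k \<le> z j}"
        using that by auto
      have "j \<in> {k \<in> {1..n}. z k \<le> z j}" "j \<notin> {k \<in> {1..n}. z k \<le> z i}"
        using that by auto
      then show "{k \<in> {1..n}. z k \<le> z i} \<noteq> {k \<in> {1..n}. z k \<le> z j}" by blast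
    qed
    then show ?thesis
      using that by (simp add: rank_perm_def psubset_card_mono)
  qed
  have inj: "inj_on (rank_perm n z) {1..n}"
  proof (rule inj_onI)
    fix i j assume ij: "i \<in> {1..n}" "j \<in> {1..n}" "rank_perm n z i = rank_perm n z j"
    then have "z i = z j"
      using less[of i j] less[of j i] by (cases "z i" "z j" rule: linorder_cases) auto
    with ij assms show "i = j" by (auto dest: inj_onD)
  qed
  have "rank_perm n z ` {1..n} \<subseteq> {1..n}"
  proof
    fix y assume "y \<in> rank_perm n z ` {1..n}"
    then obtain i where i: "i \<in> {1..n}" and y: "y = card {k \<in> {1..n}. z k \<le> z i}"
      by (auto simp: rank_perm_def)
    have "card {k \<in> {1..n}. z k \<le> z i} \<le> card {1..n}" by (rule card_mono) auto
    moreover have "card {k \<in> {1..n}. z k \<le> z i} > 0"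
      using i by (subst card_gt_0_iff) auto
    ultimately show "y \<in> {1..n}" unfolding y by (simp del: mem_Collect_eq)
  qed
  with inj have "bij_betw (rank_perm n z) {1..n} {1..n}"
    by (simp add: bij_betw_def endo_inj_surj)
  then show ?thesis
    by (rule bij_imp_permutes) (auto simp: rank_perm_def)
qed

definition inverse_unfair_perm :: "nat \<Rightarrow> (nat \<Rightarrow> nat \<Rightarrow> 'a \<Rightarrow> real) \<Rightarrow> 'a \<Rightarrow> nat \<Rightarrow> nat" where
  "inverse_unfair_perm n X \<omega> = rank_perm n (row_max X \<omega>)"

(* Subtraction on nat truncates, but 1 <= j - i already forces i < j. *)
definition m_descents :: "nat \<Rightarrow> nat \<Rightarrow> (nat \<Rightarrow> nat) \<Rightarrow> nat" where
  "m_descents n m \<sigma> =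
     card {(i, j). i \<in> {1..n} \<and> j \<in> {1..n} \<and> 1 \<le> j - i \<and> j - i \<le> m \<and> \<sigma> i > \<sigma> j}"

end

(* Write Z_i for the row maxima: they are independent, and Z_i has distribution function x^i
   on [0,1].  Since max(Z_j, Z_k) is again of this kind with exponent j + k, the event Z_i > Z_j
   has probability i / (i + j), and all joint probabilities of two descents are explicit rational
   functions.  Their covariances converge, along shifts of the index pattern, to those of a uniform
   permutation, which are
     (d(a,c) + d(b,d) - d(b,c) - d(a,d) + d(a,c) d(b,d)) / 12
   for the descents at (a,b) and (c,d), d being the Kronecker delta.  Summing over all pairs near
   a fixed row leaves m/12 per row, whence Var(D) / n -> m/12.

   For the limit law, D - E[D] is a sum of bounded centred variables with dependence of range m.
   The characteristic function f of such a sum almost satisfies the Gaussian differential equation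
   f'(t) = - v t f(t), with v the variance; the defect is O(n t^2) (Tikhomirov's method).  Hence
   |f(t) - exp(- v t^2 / 2)| = O(n |t|^3), which tends to 0 after scaling since v grows linearly. *)

theory Submission
  imports Defs "HOL-Real_Asymp.Real_Asymp"
begin

subsection \<open>Variables with a power distribution function\<close>

text \<open>The covariances converge because the model is locally uniform: for fixed e and large p,
  the p-th power of Z_(p+e) has distribution function x^((p+e)/p), which is close to x, so the
  relative order in a window of fixed width is almost that of independent uniform variables. Low
  rows have not yet reached this regime and the last rows lack some partners; neither matters for an
  average over all rows. Descents are grouped by their starting row, which makes the dependence
  one-dimensional: row i involves only Z_i, ..., Z_(i+m). Decoupling then needs two neighbourhoods,
  radius m for a single row and radius 2m for the product of a row with the rows near it; the latter
  has at most 4m+1 members, the source of that constant. The identity between the descent count and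
  a sum of indicators holds at every outcome, ties included. That ties are null is invoked
  explicitly only where a descent is replaced by the complement of the reversed one.\<close>

context prob_space
begin

lemma indep_var_sym:
  assumes "indep_var S A T B"
  shows "indep_var T B S A"
proof -
  have "indep_set P Q" if "indep_set Q P" for P Q
    using that unfolding indep_sets2_eq
    by (metis Int_commute mult.commute)
  then show ?thesis using assms by (simp add: indep_var_eq)
qed

text \<open>This is the law Beta(a, 1), that of the maximum of \<open>a\<close> independent uniform
  variables. The clamp makes one formula valid on the whole line.\<close>

definition power_law :: "nat \<Rightarrow> ('a \<Rightarrow> real) \<Rightarrow> bool" where
  "power_law a A \<longleftrightarrow> random_variable borel A \<and>
     (\<forall>x. prob {\<omega> \<in> space M. A \<omega> \<le> x} = (max 0 (min 1 x)) ^ a)"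

lemma power_law_distributed:
  assumes A: "power_law a A" and a: "1 \<le> a"
  shows "distributed M lborel A (\<lambda>x. real a * x ^ (a - 1) * indicator {0..1} x)"
proof -
  have "distributed M lborel A (\<lambda>x. ennreal (real a * x ^ (a - 1) * indicator {0..1} x))"
  proof (rule distributedI_borel_atMost)
    show "random_variable borel A" using A by (simp add: power_law_def)
    show "AE x in lborel. 0 \<le> real a * x ^ (a - 1) * indicator {0..1} x"
      by (auto simp: indicator_def)
    show "emeasure M {\<omega> \<in> space M. A \<omega> \<le> t} = ennreal ((max 0 (min 1 t)) ^ a)" for t
      using A by (simp add: power_law_def emeasure_eq_measure)
    show "(\<integral>\<^sup>+ x. ennreal (real a * x ^ (a - 1) * indicator {0..1} x * indicator {..t} x) \<partial>lborel)
      = ennreal ((max 0 (min 1 t)) ^ a)" for t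
    proof (cases "t < 0")
      case True
      then have "(\<lambda>x. ennreal (real a * x ^ (a - 1) * indicator {0..1} x * indicator {..t} x)) = (\<lambda>_. 0)"
        by (auto simp: indicator_def fun_eq_iff)
      then show ?thesis using True a by (simp add: zero_power del: mult_eq_0_iff ennreal_eq_0_iff)
    next
      case False
      have "ennreal (real a * x ^ (a - 1) * indicator {0..1} x * indicator {..t} x)
          = ennreal (real a * x ^ (a - 1)) * indicator {0..min 1 t} x" for x
        by (auto simp: indicator_def)
      then have "(\<integral>\<^sup>+ x. ennreal (real a * x ^ (a - 1) * indicator {0..1} x * indicator {..t} x) \<partial>lborel)
        = (\<integral>\<^sup>+ x. ennreal (real a * x ^ (a - 1)) * indicator {0..min 1 t} x \<partial>lborel)" by simp
      also have "\<dots> = ennreal ((min 1 t) ^ a - 0 ^ a)"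
        using False by (intro nn_integral_FTC_Icc) (auto intro!: derivative_eq_intros)
      finally show ?thesis using False a by simp
    qed
  qed auto
  then show ?thesis by simp
qed

text \<open>The clamped power with exponent \<open>b\<close> is the distribution function of another
  power law, so this expectation is a comparison probability once one variable has been integrated
  out.\<close>

lemma power_law_expectation:
  assumes A: "power_law a A" and a: "1 \<le> a"
  shows "expectation (\<lambda>\<omega>. (max 0 (min 1 (A \<omega>))) ^ b) = real a / (real a + real b)"
proof -
  have "expectation (\<lambda>\<omega>. (max 0 (min 1 (A \<omega>))) ^ b)
      = (\<integral>x. (real a * x ^ (a - 1) * indicator {0..1} x) * (max 0 (min 1 x)) ^ b \<partial>lborel)"
    by (rule distributed_integral[symmetric, OF power_law_distributed[OF A a]])
       (auto simp: indicator_def)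
  also have "\<dots> = (\<integral>x. real a * (x ^ (a - 1 + b) * indicator {0..1} x) \<partial>lborel)"
    by (intro Bochner_Integration.integral_cong) (auto simp: indicator_def power_add)
  also have "\<dots> = real a * ((1 ^ Suc (a - 1 + b) - 0 ^ Suc (a - 1 + b)) / Suc (a - 1 + b))"
    by (subst integral_mult_right_zero, subst integral_power) auto
  also have "\<dots> = real a / (real a + real b)" using a by (simp add: of_nat_diff)
  finally show ?thesis .
qed

text \<open>Fubini for the product of the two laws: for fixed \<open>B\<close>, the section has
  probability \<open>F\<close> evaluated at \<open>B\<close>.\<close>

lemma prob_le_eq_expectation_cdf:
  fixes A B :: "'a \<Rightarrow> real"
  assumes ind: "indep_var borel A borel B"
    and F: "\<And>x. prob {\<omega> \<in> space M. A \<omega> \<le> x} = F x" and [measurable]: "F \<in> borel_measurable borel"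
  shows "prob {\<omega> \<in> space M. A \<omega> \<le> B \<omega>} = expectation (\<lambda>\<omega>. F (B \<omega>))"
proof -
  have [measurable]: "random_variable borel A" "random_variable borel B"
    using ind by (auto dest: indep_var_rv1 indep_var_rv2)
  interpret A: prob_space "distr M borel A" by (rule prob_space_distr) simp
  interpret B: prob_space "distr M borel B" by (rule prob_space_distr) simp
  have F01: "0 \<le> F x" "F x \<le> 1" for x unfolding F[symmetric] by auto
  \<comment> \<open>The pair is taken with \<open>B\<close> first because the product measure is
    evaluated by integrating over the first coordinate the measure of the section in the
    second.\<close>
  have eq: "distr M borel B \<Otimes>\<^sub>M distr M borel A = distr M (borel \<Otimes>\<^sub>M borel) (\<lambda>x. (B x, A x))"
    using ind
    by (metis indep_var_distribution_eq indep_var_sym)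
  let ?S = "{p \<in> space (borel \<Otimes>\<^sub>M borel). snd p \<le> (fst p :: real)}"
  have S[measurable]: "?S \<in> sets (borel \<Otimes>\<^sub>M borel)"
    by (intro borel_measurable_le measurable_fst measurable_snd)
  have "emeasure M {\<omega> \<in> space M. A \<omega> \<le> B \<omega>}
      = emeasure (distr M (borel \<Otimes>\<^sub>M borel) (\<lambda>x. (B x, A x))) ?S"
    by (subst emeasure_distr) (use S in \<open>auto intro!: arg_cong[where f="emeasure M"] simp: space_pair_measure\<close>)
  also have "\<dots> = (\<integral>\<^sup>+x. emeasure (distr M borel A) (Pair x -` ?S) \<partial>distr M borel B)"
    unfolding eq[symmetric] by (rule A.emeasure_pair_measure_alt) (use S in simp)
  also have "\<dots> = (\<integral>\<^sup>+x. ennreal (F x) \<partial>distr M borel B)"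
  proof (intro nn_integral_cong)
    fix x
    have "emeasure (distr M borel A) (Pair x -` ?S) = emeasure M {\<omega> \<in> space M. A \<omega> \<le> x}"
      by (subst emeasure_distr) (auto intro!: arg_cong[where f="emeasure M"] simp: space_pair_measure)
    then show "emeasure (distr M borel A) (Pair x -` ?S) = ennreal (F x)"
      by (simp add: emeasure_eq_measure F)
  qed
  also have "\<dots> = (\<integral>\<^sup>+\<omega>. ennreal (F (B \<omega>)) \<partial>M)"
    by (subst nn_integral_distr) auto
  also have "\<dots> = ennreal (expectation (\<lambda>\<omega>. F (B \<omega>)))"
    using F01 by (intro nn_integral_eq_integral integrable_const_bound[where B=1]) auto
  finally show ?thesis
    using F01 by (simp add: emeasure_eq_measure)
qed

lemma power_law_prob_le:
  assumes "power_law a A" "power_law b B" "1 \<le> a" "1 \<le> b" "indep_var borel A borel B"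
  shows "prob {\<omega> \<in> space M. A \<omega> \<le> B \<omega>} = real b / (real a + real b)"
proof -
  have "prob {\<omega> \<in> space M. A \<omega> \<le> B \<omega>} = expectation (\<lambda>\<omega>. (max 0 (min 1 (B \<omega>))) ^ a)"
    using assms by (intro prob_le_eq_expectation_cdf) (auto simp: power_law_def)
  with power_law_expectation[OF assms(2,4), of a] show ?thesis by (simp add: add.commute)
qed

text \<open>The complement of the reversed weak inequality. Its value agrees with that of the weak
  inequality, so ties need no argument of their own.\<close>

lemma power_law_prob_less:
  assumes "power_law a A" "power_law b B" "1 \<le> a" "1 \<le> b" "indep_var borel A borel B"
  shows "prob {\<omega> \<in> space M. A \<omega> < B \<omega>} = real b / (real a + real b)"
proof -
  have [measurable]: "random_variable borel A" "random_variable borel B"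
    using assms by (auto simp: power_law_def)
  have "indep_var borel B borel A"
    using assms(5) by (rule indep_var_sym)
  then have "prob {\<omega> \<in> space M. B \<omega> \<le> A \<omega>} = real a / (real b + real a)"
    using assms by (intro power_law_prob_le) auto
  moreover have "prob {\<omega> \<in> space M. \<not> B \<omega> \<le> A \<omega>} = 1 - prob {\<omega> \<in> space M. B \<omega> \<le> A \<omega>}"
    by (rule prob_neg) measurable
  ultimately have "prob {\<omega> \<in> space M. A \<omega> < B \<omega>} = 1 - real a / (real b + real a)"
    by (simp add: not_le)
  then show ?thesis using assms(3) by (simp add: field_simps)
qed

text \<open>Exponents add because distribution functions of independent variables multiply under
  maxima. This turns a comparison of one variable with two others into a comparison of two
  variables.\<close>

lemma power_law_max:
  assumes "power_law a A" "power_law b B" "indep_var borel A borel B"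
  shows "power_law (a + b) (\<lambda>\<omega>. max (A \<omega>) (B \<omega>))"
proof -
  have [measurable]: "random_variable borel A" "random_variable borel B"
    using assms by (auto simp: power_law_def)
  have "prob {\<omega> \<in> space M. max (A \<omega>) (B \<omega>) \<le> x} = max 0 (min 1 x) ^ (a + b)" for x
  proof -
    have "prob {\<omega> \<in> space M. max (A \<omega>) (B \<omega>) \<le> x}
        = prob ((\<lambda>\<omega>. (A \<omega>, B \<omega>)) -` ({..x} \<times> {..x}) \<inter> space M)"
      by (intro arg_cong[where f=prob]) auto
    also have "\<dots> = prob (A -` {..x} \<inter> space M) * prob (B -` {..x} \<inter> space M)"
      by (rule indep_varD[OF assms(3)]) auto
    also have "\<dots> = prob {\<omega> \<in> space M. A \<omega> \<le> x} * prob {\<omega> \<in> space M. B \<omega> \<le> x}"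
      by (intro arg_cong2[where f="(*)"] arg_cong[where f=prob]) auto
    also have "\<dots> = max 0 (min 1 x) ^ (a + b)"
      using assms by (simp add: power_law_def power_add)
    finally show ?thesis .
  qed
  then show ?thesis by (simp add: power_law_def)
qed

lemma power_law_Max_uniform:
  assumes ind: "indep_vars (\<lambda>_. borel) U I" and I: "finite I" "I \<noteq> {}"
    and U: "\<And>j. j \<in> I \<Longrightarrow> distr M borel (U j) = uniform_measure lborel {0<..<1}"
  shows "power_law (card I) (\<lambda>\<omega>. Max ((\<lambda>j. U j \<omega>) ` I))"
proof -
  have rv[measurable]: "random_variable borel (U j)" if "j \<in> I" for j
    using ind that by (auto simp: indep_vars_def)
  have cdf: "prob (U j -` {..x} \<inter> space M) = max 0 (min 1 x)" if "j \<in> I" for j x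
  proof -
    have "prob (U j -` {..x} \<inter> space M) = measure (distr M borel (U j)) {..x}"
      using that by (subst measure_distr) auto
    also have "\<dots> = measure lborel ({0<..<1} \<inter> {..x}) / measure lborel {0<..<1::real}"
      unfolding U[OF that] by (subst measure_uniform_measure) auto
    also have "{0<..<1} \<inter> {..x} = (if x \<le> 0 then {} else if x < 1 then {0<..x} else {0<..<1})"
      by auto
    finally show ?thesis by (auto simp: not_le not_less)
  qed
  have "prob {\<omega> \<in> space M. Max ((\<lambda>j. U j \<omega>) ` I) \<le> x} = max 0 (min 1 x) ^ card I" for x
  proof -
    have "{\<omega> \<in> space M. Max ((\<lambda>j. U j \<omega>) ` I) \<le> x} = (\<Inter>j\<in>I. U j -` {..x} \<inter> space M)"
      using I by auto
    also have "prob \<dots> = (\<Prod>j\<in>I. prob (U j -` {..x} \<inter> space M))"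
      using I by (intro indep_varsD_finite[OF ind]) auto
    finally show ?thesis by (simp add: cdf)
  qed
  moreover have "random_variable borel (\<lambda>\<omega>. Max ((\<lambda>j. U j \<omega>) ` I))"
    using I by (intro borel_measurable_Max) auto
  ultimately show ?thesis by (simp add: power_law_def)
qed

text \<open>That \<open>f\<close> depends only on coordinates in \<open>J\<close> is expressed by
  invariance under \<open>restrict\<close>, so functionals written for total sequences can be used
  without changing their domain.\<close>

lemma indep_var_disjoint:
  assumes ind: "indep_vars (\<lambda>_. borel) Z I" and JK: "J \<inter> K = {}" "J \<subseteq> I" "K \<subseteq> I"
    and f: "f \<in> PiM J (\<lambda>_. borel) \<rightarrow>\<^sub>M borel" "\<And>z. f (restrict z J) = f z"
    and g: "g \<in> PiM K (\<lambda>_. borel) \<rightarrow>\<^sub>M borel" "\<And>z. g (restrict z K) = g z"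
  shows "indep_var borel (\<lambda>\<omega>. f (\<lambda>i. Z i \<omega>)) borel (\<lambda>\<omega>. g (\<lambda>i. Z i \<omega>))"
  using indep_var_compose[OF indep_var_restrict[OF ind JK] f(1) g(1)]
  by (simp add: comp_def f(2) g(2))

end

subsection \<open>Normal approximation for locally dependent sums\<close>

text \<open>Integrating factor: with \<open>E s\<close> = exp(v s^2 / 2), the derivative of
  \<open>E s * f s\<close> is \<open>E s\<close> times the defect of the equation. As
  \<open>v\<close> is nonnegative, \<open>E\<close> grows with the absolute value of its argument,
  so on the interval up to t it is at most \<open>E t\<close>, and this factor cancels when the
  result is divided by \<open>E t\<close> at the end.\<close>

lemma gaussian_ode_bound:
  fixes f :: "real \<Rightarrow> complex"
  assumes deriv: "\<And>t. (f has_vector_derivative f' t) (at t)" and f0: "f 0 = 1"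
    and bound: "\<And>t. norm (f' t + of_real (v * t) * f t) \<le> c * t\<^sup>2"
    and v: "0 \<le> v"
  shows "norm (f t - exp (- of_real (v * t\<^sup>2 / 2))) \<le> c * \<bar>t\<bar> ^ 3"
proof -
  define E where "E s = exp (v * s\<^sup>2 / 2)" for s :: real
  define g where "g s = of_real (E s) * f s" for s
  have E': "(E has_real_derivative v * s * E s) (at s)" for s
    unfolding E_def by (auto intro!: derivative_eq_intros simp: power2_eq_square)
  have g': "(g has_vector_derivative of_real (E s) * (f' s + of_real (v * s) * f s)) (at s within A)" for s A
  proof -
    have "((\<lambda>s. of_real (E s) :: complex) has_vector_derivative of_real (v * s * E s)) (at s)"
      using E'[of s] has_vector_derivative_of_real by blast
    from has_vector_derivative_mult[OF this deriv[of s]]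
    have "(g has_vector_derivative of_real (E s) * f' s + of_real (v * s * E s) * f s) (at s)"
      by (simp add: g_def[abs_def])
    then show ?thesis by (simp add: algebra_simps has_vector_derivative_at_within)
  qed
  have E_mono: "E s \<le> E t" if "\<bar>s\<bar> \<le> \<bar>t\<bar>" for s
    unfolding E_def using that v by (auto intro!: divide_right_mono mult_left_mono simp: abs_le_square_iff)
  have c0: "0 \<le> c" using order_trans[OF norm_ge_zero bound[of 1]] by simp
  have dg: "norm (of_real (E s) * (f' s + of_real (v * s) * f s)) \<le> E t * (c * t\<^sup>2)"
    if "\<bar>s\<bar> \<le> \<bar>t\<bar>" for s
  proof -
    have "norm (f' s + of_real (v * s) * f s) \<le> c * t\<^sup>2"
      using bound[of s] that c0 by (meson abs_le_square_iff mult_left_mono order_trans)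
    then show ?thesis
      using E_mono[OF that] by (auto simp: norm_mult E_def intro!: mult_mono)
  qed
  \<comment> \<open>Mean value inequality on the symmetric interval, which serves both signs of
    \<open>t\<close>.\<close>
  have "norm (g t - g 0) \<le> (E t * (c * t\<^sup>2)) * norm (t - 0)"
  proof (rule differentiable_bound)
    show "convex {-\<bar>t\<bar>..\<bar>t\<bar>}" by simp
    show "(g has_derivative (\<lambda>x. x *\<^sub>R (of_real (E s) * (f' s + of_real (v * s) * f s)))) (at s within {-\<bar>t\<bar>..\<bar>t\<bar>})" for s
      using g'[of s "{-\<bar>t\<bar>..\<bar>t\<bar>}"] by (simp add: has_vector_derivative_def)
    show "onorm (\<lambda>x. x *\<^sub>R (of_real (E s) * (f' s + of_real (v * s) * f s))) \<le> E t * (c * t\<^sup>2)"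
      if "s \<in> {-\<bar>t\<bar>..\<bar>t\<bar>}" for s
    proof (rule onorm_le)
      fix x
      have "\<bar>s\<bar> \<le> \<bar>t\<bar>" using that by auto
      from mult_left_mono[OF dg[OF this], of "\<bar>x\<bar>"]
      show "norm (x *\<^sub>R (of_real (E s) * (f' s + of_real (v * s) * f s))) \<le> E t * (c * t\<^sup>2) * norm x"
        by (simp add: mult.commute)
    qed
  qed auto
  then have le: "norm (g t - 1) \<le> E t * (c * \<bar>t\<bar> ^ 3)"
    by (simp add: g_def f0 E_def power3_eq_cube power2_eq_square)
  have Epos: "0 < E t" by (simp add: E_def)
  have e: "exp (- of_real (v * t\<^sup>2 / 2)) = (of_real (inverse (E t)) :: complex)"
    unfolding E_def by (simp only: exp_minus exp_of_real of_real_inverse)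
  have "of_real (inverse (E t)) * of_real (E t) = (1::complex)"
    using Epos by (simp flip: of_real_mult)
  then have "f t - exp (- of_real (v * t\<^sup>2 / 2)) = of_real (inverse (E t)) * (g t - 1)"
    unfolding e g_def by (simp add: right_diff_distrib flip: mult.assoc del: of_real_inverse)
  then have "norm (f t - exp (- of_real (v * t\<^sup>2 / 2))) = inverse (E t) * norm (g t - 1)"
    using Epos by (simp add: norm_mult norm_inverse)
  also have "\<dots> \<le> inverse (E t) * (E t * (c * \<bar>t\<bar> ^ 3))"
    using Epos le by (intro mult_left_mono) auto
  also have "\<dots> = c * \<bar>t\<bar> ^ 3" using Epos by (simp add: mult.assoc[symmetric] del: mult.assoc)
  finally show ?thesis .
qed

context prob_space
begin

lemma integrable_bounded:
  fixes g :: "'a \<Rightarrow> 'b::{banach, second_countable_topology}"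
  assumes "random_variable borel g" "\<And>\<omega>. norm (g \<omega>) \<le> c"
  shows "integrable M g"
  using assms by (intro integrable_const_bound[where B=c]) auto

lemma norm_expectation_le:
  fixes g :: "'a \<Rightarrow> 'b::{banach, second_countable_topology}"
  assumes "integrable M g" "\<And>\<omega>. norm (g \<omega>) \<le> c"
  shows "norm (expectation g) \<le> c"
proof -
  have "norm (expectation g) \<le> expectation (\<lambda>\<omega>. norm (g \<omega>))"
    by (rule integral_norm_bound)
  also have "\<dots> \<le> expectation (\<lambda>_. c)"
    using assms by (intro integral_mono) auto
  finally show ?thesis by (simp add: prob_space)
qed

text \<open>For bounded \<open>W\<close> the second-order Taylor remainder of the exponential is at
  most B^2 h^2 / 2 uniformly in the outcome, so it can be integrated directly and no limit is
  exchanged with the integral.\<close>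

lemma has_vector_derivative_char_bounded:
  assumes [measurable]: "random_variable borel W" and B: "\<And>\<omega>. \<bar>W \<omega>\<bar> \<le> B"
  shows "((\<lambda>t. expectation (\<lambda>\<omega>. iexp (t * W \<omega>))) has_vector_derivative
           expectation (\<lambda>\<omega>. \<i> * of_real (W \<omega>) * iexp (t * W \<omega>))) (at t)"
proof -
  let ?f = "\<lambda>t. expectation (\<lambda>\<omega>. iexp (t * W \<omega>))"
  let ?f' = "expectation (\<lambda>\<omega>. \<i> * of_real (W \<omega>) * iexp (t * W \<omega>))"
  have int1: "integrable M (\<lambda>\<omega>. iexp (s * W \<omega>))" for s
    by (intro integrable_const_bound[where B=1]) auto
  have B0: "0 \<le> B" using B[of undefined] by simp
  have int2: "integrable M (\<lambda>\<omega>. \<i> * of_real (W \<omega>) * iexp (t * W \<omega>))"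
    using B by (intro integrable_const_bound[where B=B]) (auto simp: norm_mult)
  have quad: "norm (?f (t + h) - ?f t - h *\<^sub>R ?f') \<le> B\<^sup>2 / 2 * h\<^sup>2" for h
  proof -
    have int3: "integrable M (\<lambda>\<omega>. h *\<^sub>R (\<i> * of_real (W \<omega>) * iexp (t * W \<omega>)))"
      using int2 by (rule integrable_scaleR_right)
    have "?f (t + h) - ?f t - h *\<^sub>R ?f'
        = expectation (\<lambda>\<omega>. iexp ((t + h) * W \<omega>) - iexp (t * W \<omega>) - h *\<^sub>R (\<i> * of_real (W \<omega>) * iexp (t * W \<omega>)))"
      by (simp only: Bochner_Integration.integral_diff[OF Bochner_Integration.integrable_diff[OF int1 int1] int3]
          Bochner_Integration.integral_diff[OF int1 int1] integral_scaleR_right)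
    also have "norm \<dots> \<le> B\<^sup>2 / 2 * h\<^sup>2"
    proof (rule norm_expectation_le)
      fix \<omega>
      have "iexp ((t + h) * W \<omega>) - iexp (t * W \<omega>) - h *\<^sub>R (\<i> * of_real (W \<omega>) * iexp (t * W \<omega>))
        = iexp (t * W \<omega>) * (iexp (h * W \<omega>) - (1 + \<i> * of_real (h * W \<omega>)))"
        by (simp add: algebra_simps exp_add scaleR_conv_of_real)
      also have "norm \<dots> = norm (iexp (h * W \<omega>) - (1 + \<i> * of_real (h * W \<omega>)))"
        by (simp add: norm_mult)
      also have "\<dots> \<le> \<bar>h * W \<omega>\<bar>\<^sup>2 / 2"
        using iexp_approx1[of "h * W \<omega>" 1] by (simp add: numeral_2_eq_2)
      also have "\<dots> = h\<^sup>2 * (W \<omega>)\<^sup>2 / 2" by (simp add: power_mult_distrib)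
      also have "\<dots> \<le> h\<^sup>2 * B\<^sup>2 / 2"
        using B[of \<omega>] B0 by (auto intro!: divide_right_mono mult_left_mono simp: abs_le_square_iff[symmetric])
      finally show "norm (iexp ((t + h) * W \<omega>) - iexp (t * W \<omega>) - h *\<^sub>R (\<i> * of_real (W \<omega>) * iexp (t * W \<omega>)))
          \<le> B\<^sup>2 / 2 * h\<^sup>2" by (simp add: mult.commute)
    qed (rule Bochner_Integration.integrable_diff[OF Bochner_Integration.integrable_diff[OF int1 int1] int3])
    finally show ?thesis .
  qed
  have "((\<lambda>h. norm (?f (t + h) - ?f t - h *\<^sub>R ?f') / norm h) \<longlongrightarrow> 0) (at 0)"
  proof (rule tendsto_sandwich[OF _ _ tendsto_const])
    show "\<forall>\<^sub>F h in at 0. norm (?f (t + h) - ?f t - h *\<^sub>R ?f') / norm h \<le> B\<^sup>2 / 2 * \<bar>h\<bar>"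
    proof (rule eventually_mono[OF eventually_neq_at_within[of 0]])
      fix h :: real assume "h \<noteq> 0"
      then show "norm (?f (t + h) - ?f t - h *\<^sub>R ?f') / norm h \<le> B\<^sup>2 / 2 * \<bar>h\<bar>"
        using quad[of h] by (simp add: divide_le_eq power2_eq_square mult.assoc)
    qed
    show "((\<lambda>h::real. B\<^sup>2 / 2 * \<bar>h\<bar>) \<longlongrightarrow> 0) (at 0)"
      by (auto intro!: tendsto_eq_intros)
  qed auto
  then show ?thesis
    unfolding has_vector_derivative_def has_derivative_at
    by (auto intro!: bounded_linear_intros)
qed

text \<open>The sum outside \<open>A i\<close> is independent of \<open>Y i\<close>; the larger neighbourhood \<open>B i\<close> is needed
  because the second-order term \<open>Y i * (\<Sum>j\<in>A i. Y j)\<close> has to be decoupled in turn.\<close>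

lemma char_locally_dependent_approx:
  fixes Y :: "'i \<Rightarrow> 'a \<Rightarrow> real"
  assumes I: "finite I" and AB: "\<And>i. i \<in> I \<Longrightarrow> A i \<subseteq> B i" "\<And>i. i \<in> I \<Longrightarrow> B i \<subseteq> I"
    and card: "\<And>i. i \<in> I \<Longrightarrow> card (B i) \<le> b"
    and Y[measurable]: "\<And>i. i \<in> I \<Longrightarrow> random_variable borel (Y i)"
    and K: "\<And>i \<omega>. i \<in> I \<Longrightarrow> \<bar>Y i \<omega>\<bar> \<le> K"
    and mean: "\<And>i. i \<in> I \<Longrightarrow> expectation (Y i) = 0"
    and ind1: "\<And>i. i \<in> I \<Longrightarrow> indep_var borel (Y i) borel (\<lambda>\<omega>. \<Sum>j\<in>I - A i. Y j \<omega>)"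
    and ind2: "\<And>i. i \<in> I \<Longrightarrow>
       indep_var borel (\<lambda>\<omega>. Y i \<omega> * (\<Sum>j\<in>A i. Y j \<omega>)) borel (\<lambda>\<omega>. \<Sum>j\<in>I - B i. Y j \<omega>)"
  defines "W \<equiv> \<lambda>\<omega>. \<Sum>i\<in>I. Y i \<omega>"
    and "v \<equiv> (\<Sum>i\<in>I. expectation (\<lambda>\<omega>. Y i \<omega> * (\<Sum>j\<in>A i. Y j \<omega>)))"
  shows "expectation (\<lambda>\<omega>. (W \<omega>)\<^sup>2) = v"
    and "norm (expectation (\<lambda>\<omega>. iexp (t * W \<omega>)) - exp (- of_real (v * t\<^sup>2 / 2)))
           \<le> real (card I) * (4 * K ^ 3 * real b ^ 2) * \<bar>t\<bar> ^ 3"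
proof -
  let ?f = "\<lambda>t. expectation (\<lambda>\<omega>. iexp (t * W \<omega>))"
  define V where "V i \<omega> = (\<Sum>j\<in>A i. Y j \<omega>)" for i \<omega>
  define P where "P i \<omega> = (\<Sum>j\<in>I - A i. Y j \<omega>)" for i \<omega>
  define U where "U i \<omega> = (\<Sum>j\<in>B i. Y j \<omega>)" for i \<omega>
  define Q where "Q i \<omega> = (\<Sum>j\<in>I - B i. Y j \<omega>)" for i \<omega>
  have AI: "A i \<subseteq> I" if "i \<in> I" for i using AB that by blast
  have finA: "finite (A i)" and finB: "finite (B i)" if "i \<in> I" for i
    using AI[OF that] AB[OF that] I by (auto intro: finite_subset)
  have cardA: "card (A i) \<le> b" if "i \<in> I" for i
    using card_mono[OF finB AB(1), of i] card[of i] that by auto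
  have Wm[measurable]: "random_variable borel W" unfolding W_def by measurable
  have Vm[measurable]: "random_variable borel (V i)" if "i \<in> I" for i
    unfolding V_def using AI[OF that] by (intro borel_measurable_sum Y) auto
  have Um[measurable]: "random_variable borel (U i)" if "i \<in> I" for i
    unfolding U_def using AB[OF that] by (intro borel_measurable_sum Y) auto
  have Pm[measurable]: "random_variable borel (P i)" if "i \<in> I" for i
    unfolding P_def by (intro borel_measurable_sum Y) auto
  have Qm[measurable]: "random_variable borel (Q i)" if "i \<in> I" for i
    unfolding Q_def by (intro borel_measurable_sum Y) auto
  have WVP: "W \<omega> = V i \<omega> + P i \<omega>" if "i \<in> I" for i \<omega>
    unfolding W_def V_def P_def using sum.subset_diff[OF AI[OF that] I] by (simp add: add.commute)
  have WUQ: "W \<omega> = U i \<omega> + Q i \<omega>" if "i \<in> I" for i \<omega>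
    unfolding W_def U_def Q_def using sum.subset_diff[OF AB(2)[OF that] I] by (simp add: add.commute)
  \<comment> \<open>The sign of \<open>K\<close> is known only through some element of
    \<open>I\<close>. For empty \<open>I\<close> the final bounds hold because \<open>card I\<close>
    vanishes, whence the case distinctions on \<open>I\<close>.\<close>
  have K0: "0 \<le> K" if "i \<in> I" for i using K[OF that, of undefined] by simp
  have bd: "\<bar>\<Sum>j\<in>J. Y j \<omega>\<bar> \<le> real c * K" if "J \<subseteq> I" "card J \<le> c" "i \<in> I" for J \<omega> c i
  proof -
    have "\<bar>\<Sum>j\<in>J. Y j \<omega>\<bar> \<le> real (card J) * K"
      using that K by (intro order_trans[OF sum_abs] sum_bounded_above) auto
    also have "\<dots> \<le> real c * K" using that K0 by (intro mult_right_mono) auto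
    finally show ?thesis .
  qed
  have Vb: "\<bar>V i \<omega>\<bar> \<le> real b * K" if "i \<in> I" for i \<omega>
    unfolding V_def using bd[OF AI[OF that] cardA[OF that] that] .
  have Ub: "\<bar>U i \<omega>\<bar> \<le> real b * K" if "i \<in> I" for i \<omega>
    unfolding U_def using bd[OF AB(2)[OF that] card[OF that] that] .
  have Pb: "\<bar>P i \<omega>\<bar> \<le> real (card I) * K" if "i \<in> I" for i \<omega>
    unfolding P_def using that I by (intro bd[of _ _ i] card_mono) auto
  have Wb: "\<bar>W \<omega>\<bar> \<le> real (card I) * K" for \<omega>
    unfolding W_def using bd[of I "card I"] by (cases "I = {}") auto
  have YV: "\<bar>Y i \<omega> * V i \<omega>\<bar> \<le> K * (real b * K)" if "i \<in> I" for i \<omega>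
    unfolding abs_mult using K Vb K0 that by (intro mult_mono) auto
  have intY: "integrable M (Y i)" if "i \<in> I" for i
    using K[OF that] that by (intro integrable_bounded[where c=K]) auto
  have intYV: "integrable M (\<lambda>\<omega>. Y i \<omega> * V i \<omega>)" if "i \<in> I" for i
    using YV[OF that] that by (intro integrable_bounded[where c="K * (real b * K)"]) auto
  have intP: "integrable M (P i)" if "i \<in> I" for i
    using Pb[OF that] that by (intro integrable_bounded[where c="real (card I) * K"]) auto
  have indYP: "indep_var borel (Y i) borel (P i)" if "i \<in> I" for i
    using ind1[OF that] by (simp add: P_def[abs_def])
  have intYP: "integrable M (\<lambda>\<omega>. Y i \<omega> * P i \<omega>)" if "i \<in> I" for i
    using indep_var_integrable[OF indYP intY intP] that by simp
  have EYP: "expectation (\<lambda>\<omega>. Y i \<omega> * P i \<omega>) = 0" if "i \<in> I" for i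
    using indep_var_lebesgue_integral[OF indYP intY intP] that mean by simp
  have EYW: "expectation (\<lambda>\<omega>. Y i \<omega> * W \<omega>) = expectation (\<lambda>\<omega>. Y i \<omega> * V i \<omega>)" if "i \<in> I" for i
    using intYV[OF that] intYP[OF that] EYP[OF that] by (simp add: WVP[OF that] distrib_left)
  have intYW: "integrable M (\<lambda>\<omega>. Y i \<omega> * W \<omega>)" if "i \<in> I" for i
    using intYV[OF that] intYP[OF that] by (simp add: WVP[OF that] distrib_left)
  have "(W \<omega>)\<^sup>2 = (\<Sum>i\<in>I. Y i \<omega> * W \<omega>)" for \<omega>
    unfolding power2_eq_square by (subst (1) W_def) (rule sum_distrib_right)
  then have "expectation (\<lambda>\<omega>. (W \<omega>)\<^sup>2) = (\<Sum>i\<in>I. expectation (\<lambda>\<omega>. Y i \<omega> * W \<omega>))"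
    using intYW by (simp only: Bochner_Integration.integral_sum)
  also have "\<dots> = v" unfolding v_def V_def[symmetric] by (intro sum.cong refl EYW)
  finally show var: "expectation (\<lambda>\<omega>. (W \<omega>)\<^sup>2) = v" .
  have v0: "0 \<le> v" unfolding var[symmetric] by (rule Bochner_Integration.integral_nonneg) simp

  have local_approx: "norm (expectation (\<lambda>\<omega>. of_real (Y i \<omega>) * iexp (t * W \<omega>))
      - \<i> * of_real (t * expectation (\<lambda>\<omega>. Y i \<omega> * V i \<omega>)) * ?f t) \<le> 4 * K ^ 3 * real b ^ 2 * t\<^sup>2"
    if i: "i \<in> I" for i t
  proof -
    \<comment> \<open>Expansion of \<open>Y i\<close> times the exponential of W = V + P = U + Q.
      Taylor's formula in \<open>V i\<close> gives the term \<open>?e1\<close> of order zero, with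
      mean 0 by independence and centring, a linear term, and the remainder \<open>?r1\<close>. In
      the linear term \<open>P i\<close> is exchanged for \<open>Q i\<close> at the cost
      \<open>?r2\<close>; what is left, \<open>?e2\<close>, factorises by the second independence
      assumption. Finally \<open>?r3\<close> is the cost of returning from \<open>Q i\<close> to
      \<open>W\<close>, so that the full characteristic function reappears.\<close>
    let ?e1 = "\<lambda>\<omega>. of_real (Y i \<omega>) * iexp (t * P i \<omega>)"
    let ?r1 = "\<lambda>\<omega>. of_real (Y i \<omega>) * iexp (t * P i \<omega>) * (iexp (t * V i \<omega>) - (1 + \<i> * of_real (t * V i \<omega>)))"
    let ?r2 = "\<lambda>\<omega>. \<i> * of_real (t * (Y i \<omega> * V i \<omega>)) * (iexp (t * P i \<omega>) - iexp (t * Q i \<omega>))"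
    let ?e2 = "\<lambda>\<omega>. \<i> * of_real t * (of_real (Y i \<omega> * V i \<omega>) * iexp (t * Q i \<omega>))"
    let ?r3 = "\<lambda>\<omega>. iexp (t * Q i \<omega>) - iexp (t * W \<omega>)"
    note [measurable] = Y[OF i] Vm[OF i] Um[OF i] Pm[OF i] Qm[OF i]
    note k0 = K0[OF i]
    have lip: "norm (iexp x - iexp y) \<le> \<bar>x - y\<bar>" for x y
    proof -
      have "iexp x - iexp y = iexp y * (iexp (x - y) - 1)"
        by (simp add: algebra_simps exp_diff)
      then show ?thesis using iexp_approx1[of "x - y" 0] by (simp add: norm_mult)
    qed
    have b1: "norm (?r1 \<omega>) \<le> K * (\<bar>t\<bar> * (real b * K))\<^sup>2 / 2" for \<omega>
    proof -
      have "norm (iexp (t * V i \<omega>) - (1 + \<i> * of_real (t * V i \<omega>))) \<le> \<bar>t * V i \<omega>\<bar>\<^sup>2 / 2"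
        using iexp_approx1[of "t * V i \<omega>" 1] by (simp add: numeral_2_eq_2)
      also have "\<dots> \<le> (\<bar>t\<bar> * (real b * K))\<^sup>2 / 2"
        using Vb[OF i] by (intro divide_right_mono power_mono) (auto simp: abs_mult intro: mult_left_mono)
      finally have "norm (of_real (Y i \<omega>) * iexp (t * P i \<omega>)) *
          norm (iexp (t * V i \<omega>) - (1 + \<i> * of_real (t * V i \<omega>))) \<le> K * ((\<bar>t\<bar> * (real b * K))\<^sup>2 / 2)"
        using K[OF i] k0 by (intro mult_mono) (auto simp: norm_mult)
      then show ?thesis by (simp add: norm_mult)
    qed
    have b3: "norm (?r3 \<omega>) \<le> \<bar>t\<bar> * (real b * K)" for \<omega>
    proof -
      have "norm (?r3 \<omega>) \<le> \<bar>t * Q i \<omega> - t * W \<omega>\<bar>" by (rule lip)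
      also have "\<dots> = \<bar>t\<bar> * \<bar>U i \<omega>\<bar>"
        by (simp add: WUQ[OF i] abs_mult[symmetric] algebra_simps)
      also have "\<dots> \<le> \<bar>t\<bar> * (real b * K)" using Ub[OF i] by (intro mult_left_mono) auto
      finally show ?thesis .
    qed
    have b2: "norm (?r2 \<omega>) \<le> (\<bar>t\<bar> * (K * (real b * K))) * (2 * (\<bar>t\<bar> * (real b * K)))" for \<omega>
    proof -
      have "norm (iexp (t * P i \<omega>) - iexp (t * Q i \<omega>)) \<le> \<bar>t * P i \<omega> - t * Q i \<omega>\<bar>" by (rule lip)
      also have "\<dots> = \<bar>t\<bar> * \<bar>U i \<omega> - V i \<omega>\<bar>"
      proof -
        have "P i \<omega> - Q i \<omega> = U i \<omega> - V i \<omega>"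
          using WVP[OF i, of \<omega>] WUQ[OF i, of \<omega>] by linarith
        then show ?thesis by (simp only: right_diff_distrib[symmetric] abs_mult)
      qed
      also have "\<dots> \<le> \<bar>t\<bar> * (2 * (real b * K))"
        using Vb[OF i, of \<omega>] Ub[OF i, of \<omega>] by (intro mult_left_mono) auto
      finally have *: "norm (iexp (t * P i \<omega>) - iexp (t * Q i \<omega>)) \<le> 2 * (\<bar>t\<bar> * (real b * K))" by simp
      have "norm (\<i> * of_real (t * (Y i \<omega> * V i \<omega>)) :: complex) \<le> \<bar>t\<bar> * (K * (real b * K))"
        using YV[OF i, of \<omega>] by (simp add: norm_mult abs_mult mult_left_mono)
      with * show ?thesis unfolding norm_mult[of _ "_ - _"] using k0 by (intro mult_mono) auto
    qed
    have m1: "random_variable borel ?r1" and m2: "random_variable borel ?r2"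
      and m3: "random_variable borel ?r3" by measurable
    have i1: "integrable M ?r1" by (rule integrable_bounded[OF m1 b1])
    have i2: "integrable M ?r2" by (rule integrable_bounded[OF m2 b2])
    have i3: "integrable M ?r3" by (rule integrable_bounded[OF m3 b3])
    have j1: "integrable M ?e1"
      using K[OF i] by (intro integrable_bounded[where c=K]) (auto simp: norm_mult)
    have j2': "integrable M (\<lambda>\<omega>. of_real (Y i \<omega> * V i \<omega>) * iexp (t * Q i \<omega>))"
      using YV[OF i] by (intro integrable_bounded[where c="K * (real b * K)"]) (auto simp: norm_mult abs_mult)
    then have j2: "integrable M ?e2" by (rule integrable_mult_right)
    have jP: "integrable M (\<lambda>\<omega>. iexp (t * P i \<omega>))" by (intro integrable_bounded[where c=1]) auto
    have jQ: "integrable M (\<lambda>\<omega>. iexp (t * Q i \<omega>))" by (intro integrable_bounded[where c=1]) auto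
    have jW: "integrable M (\<lambda>\<omega>. iexp (t * W \<omega>))" by (intro integrable_bounded[where c=1]) auto
    have "indep_var borel (of_real \<circ> Y i) borel ((\<lambda>x. iexp (t * x)) \<circ> P i)"
      by (rule indep_var_compose[OF indYP[OF i]]) auto
    then have e1: "expectation ?e1 = 0"
      using indep_var_lebesgue_integral[of "\<lambda>\<omega>. of_real (Y i \<omega>)" "\<lambda>\<omega>. iexp (t * P i \<omega>)"]
        jP intY[OF i] mean[OF i] by (simp add: comp_def)
    have "indep_var borel (of_real \<circ> (\<lambda>\<omega>. Y i \<omega> * V i \<omega>)) borel ((\<lambda>x. iexp (t * x)) \<circ> Q i)"
      using ind2[OF i] by (intro indep_var_compose) (auto simp: V_def Q_def[abs_def])
    then have e2: "expectation ?e2 = \<i> * of_real t * (of_real (expectation (\<lambda>\<omega>. Y i \<omega> * V i \<omega>)) * expectation (\<lambda>\<omega>. iexp (t * Q i \<omega>)))"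
      using indep_var_lebesgue_integral[of "\<lambda>\<omega>. of_real (Y i \<omega> * V i \<omega>)" "\<lambda>\<omega>. iexp (t * Q i \<omega>)"]
        jQ intYV[OF i] j2' integral_complex_of_real[of M "\<lambda>\<omega>. Y i \<omega> * V i \<omega>"]
      by (simp add: comp_def del: of_real_mult)
    have "of_real (Y i \<omega>) * iexp (t * W \<omega>) = ?e1 \<omega> + ?r1 \<omega> + ?r2 \<omega> + ?e2 \<omega>" for \<omega>
      by (simp add: WVP[OF i] distrib_left exp_add algebra_simps)
    then have "expectation (\<lambda>\<omega>. of_real (Y i \<omega>) * iexp (t * W \<omega>))
        = expectation ?r1 + expectation ?r2 + expectation ?e2"
      using i1 i2 j1 j2 e1 by simp
    moreover have "expectation (\<lambda>\<omega>. iexp (t * Q i \<omega>)) = ?f t + expectation ?r3"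
      using jQ jW by simp
    ultimately have "expectation (\<lambda>\<omega>. of_real (Y i \<omega>) * iexp (t * W \<omega>))
        - \<i> * of_real (t * expectation (\<lambda>\<omega>. Y i \<omega> * V i \<omega>)) * ?f t
        = expectation ?r1 + expectation ?r2
          + \<i> * of_real (t * expectation (\<lambda>\<omega>. Y i \<omega> * V i \<omega>)) * expectation ?r3"
      unfolding e2 by (simp add: algebra_simps)
    also have "norm \<dots> \<le> K * (\<bar>t\<bar> * (real b * K))\<^sup>2 / 2
        + (\<bar>t\<bar> * (K * (real b * K))) * (2 * (\<bar>t\<bar> * (real b * K)))
        + (\<bar>t\<bar> * (K * (real b * K))) * (\<bar>t\<bar> * (real b * K))"
    proof (intro norm_triangle_mono)
      show "norm (expectation ?r1) \<le> K * (\<bar>t\<bar> * (real b * K))\<^sup>2 / 2" by (rule norm_expectation_le[OF i1 b1])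
      show "norm (expectation ?r2) \<le> (\<bar>t\<bar> * (K * (real b * K))) * (2 * (\<bar>t\<bar> * (real b * K)))"
        by (rule norm_expectation_le[OF i2 b2])
      have "\<bar>expectation (\<lambda>\<omega>. Y i \<omega> * V i \<omega>)\<bar> \<le> K * (real b * K)"
        using norm_expectation_le[OF intYV[OF i]] YV[OF i] by simp
      then have "norm (\<i> * of_real (t * expectation (\<lambda>\<omega>. Y i \<omega> * V i \<omega>)) :: complex)
          \<le> \<bar>t\<bar> * (K * (real b * K))"
        by (simp add: norm_mult abs_mult mult_left_mono)
      moreover have "norm (expectation ?r3) \<le> \<bar>t\<bar> * (real b * K)" by (rule norm_expectation_le[OF i3 b3])
      ultimately show "norm (\<i> * of_real (t * expectation (\<lambda>\<omega>. Y i \<omega> * V i \<omega>)) * expectation ?r3)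
        \<le> (\<bar>t\<bar> * (K * (real b * K))) * (\<bar>t\<bar> * (real b * K))"
        unfolding norm_mult[of _ "expectation ?r3"] using k0 by (intro mult_mono) auto
    qed
    \<comment> \<open>The three errors contribute 1/2, 2 and 1; the sum is rounded up to 4
      below.\<close>
    also have "\<dots> = 7 / 2 * (K ^ 3 * real b ^ 2 * t\<^sup>2)"
      by (simp add: power2_eq_square power3_eq_cube algebra_simps abs_mult_self_eq)
    also have "\<dots> \<le> 4 * (K ^ 3 * real b ^ 2 * t\<^sup>2)"
      using k0 by (intro mult_right_mono) auto
    finally show ?thesis by simp
  qed

  show "norm (?f t - exp (- of_real (v * t\<^sup>2 / 2))) \<le> (real (card I) * (4 * K ^ 3 * real b ^ 2)) * \<bar>t\<bar> ^ 3"
  proof (rule gaussian_ode_bound[OF has_vector_derivative_char_bounded[OF Wm Wb] _ _ v0])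
    show "?f 0 = 1" by (simp add: prob_space)
    fix t
    have int: "integrable M (\<lambda>\<omega>. of_real (Y i \<omega>) * iexp (t * W \<omega>))" if "i \<in> I" for i
      using K[OF that] Y[OF that] by (intro integrable_bounded[where c=K]) (auto simp: norm_mult)
    have "\<i> * of_real (W \<omega>) * iexp (t * W \<omega>)
        = \<i> * (\<Sum>i\<in>I. of_real (Y i \<omega>) * iexp (t * W \<omega>))" for \<omega>
      by (subst W_def) (simp only: of_real_sum sum_distrib_right mult.assoc)
    then have "expectation (\<lambda>\<omega>. \<i> * of_real (W \<omega>) * iexp (t * W \<omega>))
        = \<i> * (\<Sum>i\<in>I. expectation (\<lambda>\<omega>. of_real (Y i \<omega>) * iexp (t * W \<omega>)))"
      using int by (simp only: integral_mult_right_zero Bochner_Integration.integral_sum)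
    \<comment> \<open>The factor \<open>- \<i> * \<i>\<close> = 1 is inserted so that this sum can
      be merged term by term with that of the derivative, which carries a factor
      \<open>\<i>\<close>.\<close>
    moreover have "of_real (v * t) * ?f t
        = - \<i> * (\<Sum>i\<in>I. \<i> * of_real (t * expectation (\<lambda>\<omega>. Y i \<omega> * V i \<omega>)) * ?f t)"
    proof -
      have "v * t = (\<Sum>i\<in>I. t * expectation (\<lambda>\<omega>. Y i \<omega> * V i \<omega>))"
        by (simp only: v_def V_def sum_distrib_right mult.commute[of t])
      then have "of_real (v * t) * ?f t = (\<Sum>i\<in>I. of_real (t * expectation (\<lambda>\<omega>. Y i \<omega> * V i \<omega>)) * ?f t)"
        by (simp only: of_real_sum sum_distrib_right)
      then show ?thesis by (simp add: sum_distrib_left mult.assoc[symmetric])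
    qed
    ultimately have "expectation (\<lambda>\<omega>. \<i> * of_real (W \<omega>) * iexp (t * W \<omega>)) + of_real (v * t) * ?f t
      = \<i> * (\<Sum>i\<in>I. expectation (\<lambda>\<omega>. of_real (Y i \<omega>) * iexp (t * W \<omega>))
          - \<i> * of_real (t * expectation (\<lambda>\<omega>. Y i \<omega> * V i \<omega>)) * ?f t)"
      by (simp only: sum_subtractf right_diff_distrib mult_minus_left add_uminus_conv_diff)
    also have "norm \<dots> \<le> real (card I) * (4 * K ^ 3 * real b ^ 2 * t\<^sup>2)"
      unfolding norm_mult using local_approx
      by (simp, intro order_trans[OF norm_sum] sum_bounded_above) auto
    finally show "norm (expectation (\<lambda>\<omega>. \<i> * of_real (W \<omega>) * iexp (t * W \<omega>)) + of_real (v * t) * ?f t)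
      \<le> real (card I) * (4 * K ^ 3 * real b ^ 2) * t\<^sup>2" by (simp add: mult.assoc)
  qed
qed

end

subsection \<open>Covariances of descents\<close>

definition desc :: "(nat \<Rightarrow> real) \<Rightarrow> nat \<Rightarrow> nat \<Rightarrow> real" where
  "desc z a b = of_bool (z b < z a)"

text \<open>The branches give the covariance of the descents at \<open>a < b\<close> and \<open>c < d\<close> only; they do not
  anticipate patterns such as \<open>a = d \<and> b = c\<close>.\<close>

definition desc_cov :: "nat \<Rightarrow> nat \<Rightarrow> nat \<Rightarrow> nat \<Rightarrow> real" where
  "desc_cov a b c d =
    (if a = c \<and> b = d then a / (a + b) - (a / (a + b)) * (a / (a + b))
     else if a = c then a / (a + b + d) - (a / (a + b)) * (a / (a + d))
     else if b = d then 1 - b / (b + a) - b / (b + c) + b / (b + a + c) - (a / (a + b)) * (c / (c + b))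
     else if b = c then b / (b + d) - b / (b + a + d) - (a / (a + b)) * (b / (b + d))
     else if a = d then a / (a + b) - a / (a + c + b) - (a / (a + b)) * (c / (c + a))
     else 0)"

text \<open>All indices are \<open>p\<close> plus a constant, so a/(a+b) tends to 1/2 and a/(a+b+c)
  to 1/3. The values are 1/2 - 1/4 for equal pairs, 1/3 - 1/4 for a common start or a common end,
  and 1/2 - 1/3 - 1/4 = -1/12 for a chain. The first start is placed at \<open>p + m\<close> so that
  natural offsets \<open>e\<close> cover both sides of it.\<close>

lemma desc_cov_limit:
  assumes "1 \<le> k" "1 \<le> l"
  shows "(\<lambda>p. desc_cov (p + m) (p + m + k) (p + e) (p + e + l)) \<longlonglongrightarrow>
     (of_bool (e = m) + of_bool (e + l = m + k) - of_bool (e = m + k) - of_bool (e + l = m)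
        + of_bool (e = m \<and> k = l)) / 12"
proof -
  consider "e = m" "k = l" | "e = m" "k \<noteq> l" | "e \<noteq> m" "e + l = m + k"
    | "e = m + k" | "m = e + l" | "e \<noteq> m" "e + l \<noteq> m + k" "e \<noteq> m + k" "m \<noteq> e + l" by blast
  then show ?thesis
  proof cases
    case 1
    have "(\<lambda>p. real (p + m) / real (p + m + (p + m + k))
        - real (p + m) / real (p + m + (p + m + k)) * (real (p + m) / real (p + m + (p + m + k)))) \<longlonglongrightarrow> 1/4"
      by real_asymp
    then show ?thesis using 1 assms by (simp add: desc_cov_def)
  next
    case 2
    have "(\<lambda>p. real (p + m) / real (p + m + (p + m + k) + (p + m + l))
        - real (p + m) / real (p + m + (p + m + k)) * (real (p + m) / real (p + m + (p + m + l)))) \<longlonglongrightarrow> 1/12"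
      by real_asymp
    then show ?thesis using 2 assms by (simp add: desc_cov_def)
  next
    case 3
    have "(\<lambda>p. 1 - real (p + m + k) / real (p + m + k + (p + m)) - real (p + m + k) / real (p + m + k + (p + e))
         + real (p + m + k) / real (p + m + k + (p + m) + (p + e))
        - real (p + m) / real (p + m + (p + m + k)) * (real (p + e) / real (p + e + (p + m + k)))) \<longlonglongrightarrow> 1/12"
      by real_asymp
    then show ?thesis using 3 assms by (simp add: desc_cov_def add.assoc)
  next
    case 4
    have "(\<lambda>p. real (p + m + k) / real (p + m + k + (p + m + k + l))
         - real (p + m + k) / real (p + m + k + (p + m) + (p + m + k + l))
        - real (p + m) / real (p + m + (p + m + k)) * (real (p + m + k) / real (p + m + k + (p + m + k + l)))) \<longlonglongrightarrow> -1/12"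
      by real_asymp
    then show ?thesis using 4 assms by (simp add: desc_cov_def add.assoc)
  next
    case 5
    have "(\<lambda>p. real (p + m) / real (p + m + (p + m + k))
         - real (p + m) / real (p + m + (p + e) + (p + m + k))
        - real (p + m) / real (p + m + (p + m + k)) * (real (p + e) / real (p + e + (p + m)))) \<longlonglongrightarrow> -1/12"
      by real_asymp
    then show ?thesis using 5 assms by (simp add: desc_cov_def add.assoc)
  next
    case 6
    then show ?thesis using assms by (simp add: desc_cov_def add.assoc)
  qed
qed

text \<open>For fixed \<open>k\<close> and \<open>l\<close>, each of the four single coincidences
  occurs for exactly one \<open>e\<close>, and two positive signs cancel two negative ones. Only the
  joint term with \<open>e = m\<close> and \<open>k = l\<close> survives, once for each of the
  \<open>m\<close> gaps.\<close>

lemma desc_cov_limit_sum: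
  "(\<Sum>e\<le>2 * m. \<Sum>k=1..m. \<Sum>l=1..m.
     (of_bool (e = m) + of_bool (e + l = m + k) - of_bool (e = m + k) - of_bool (e + l = m)
        + of_bool (e = m \<and> k = l)) / 12) = real m / 12"
proof -
  have pt: "(\<Sum>e\<le>2 * m. of_bool (e = x)) = (1::real)" if "x \<le> 2 * m" for x
    using that by (simp add: of_bool_def)
  have inner: "(\<Sum>e\<le>2 * m. of_bool (e = m) + of_bool (e + l = m + k) - of_bool (e = m + k)
      - of_bool (e + l = m) + of_bool (e = m \<and> k = l)) = (of_bool (k = l) :: real)"
    if "k \<in> {1..m}" "l \<in> {1..m}" for k l
  proof -
    have "e + l = m + k \<longleftrightarrow> e = m + k - l" "e + l = m \<longleftrightarrow> e = m - l" for e
      using that by auto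
    then have "(\<Sum>e\<le>2 * m. of_bool (e = m) + of_bool (e + l = m + k) - of_bool (e = m + k)
      - of_bool (e + l = m) + of_bool (e = m \<and> k = l))
      = (\<Sum>e\<le>2 * m. of_bool (e = m) + of_bool (e = m + k - l) - of_bool (e = m + k)
      - of_bool (e = m - l) + of_bool (e = m) * of_bool (k = l) :: real)"
      by (intro sum.cong) auto
    also have "\<dots> = of_bool (k = l)"
    proof -
      \<comment> \<open>The four coincidence points all lie in the summation range, whatever the
        gaps; otherwise the cancellation would be incomplete.\<close>
      have "m \<le> 2 * m" "m + k - l \<le> 2 * m" "m + k \<le> 2 * m" "m - l \<le> 2 * m" using that by auto
      note pts = this[THEN pt]
      show ?thesis by (simp only: sum.distrib sum_subtractf sum_distrib_right[symmetric] pts)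
    qed
    finally show ?thesis .
  qed
  have "(\<Sum>e\<le>2 * m. \<Sum>k=1..m. \<Sum>l=1..m.
     (of_bool (e = m) + of_bool (e + l = m + k) - of_bool (e = m + k) - of_bool (e + l = m)
        + of_bool (e = m \<and> k = l)) / 12)
    = (\<Sum>k=1..m. \<Sum>l=1..m. (\<Sum>e\<le>2 * m.
     of_bool (e = m) + of_bool (e + l = m + k) - of_bool (e = m + k) - of_bool (e + l = m)
        + of_bool (e = m \<and> k = l))) / (12::real)"
    unfolding sum_divide_distrib
    by (subst sum.swap, rule sum.cong[OF refl], rule sum.swap)
  also have "\<dots> = (\<Sum>k=1..m. \<Sum>l=1..m. of_bool (k = l)) / 12"
    by (intro arg_cong2[where f="(/)"] sum.cong refl inner)
  also have "\<dots> = real m / 12" by (simp add: of_bool_def)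
  finally show ?thesis .
qed

section \<open>Averages of a bounded triangular array that is regular in its interior\<close>

text \<open>A Cesaro argument with boundary. Row \<open>p + m\<close> has neighbours up to
  \<open>p + 2 * m\<close>, whose partners reach \<open>p + 3 * m\<close>; this explains the shape
  of the interior condition.\<close>

lemma average_limit:
  fixes w :: "nat \<Rightarrow> nat \<Rightarrow> real"
  assumes bound: "\<And>n i. 1 \<le> n \<Longrightarrow> i \<in> {1..n} \<Longrightarrow> \<bar>w n i\<bar> \<le> B"
    and v: "v \<longlonglongrightarrow> L"
    and interior: "\<And>n p. 1 \<le> p \<Longrightarrow> p + 3 * m \<le> n \<Longrightarrow> w n (p + m) = v p"
  shows "(\<lambda>n. (\<Sum>i\<in>{1..n}. w n i) / real n) \<longlonglongrightarrow> L"
proof (rule LIMSEQ_I)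
  fix r :: real assume r: "0 < r"
  then obtain N where N: "\<And>p. N \<le> p \<Longrightarrow> \<bar>v p - L\<bar> < r / 2"
    using LIMSEQ_D[OF v, of "r / 2"] by auto
  have B0: "0 \<le> B" using bound[of 1 1] by simp
  define C where "C = real (N + 1 + 3 * m) * (B + \<bar>L\<bar>)"
  have C0: "0 \<le> C" unfolding C_def using B0 by simp
  have main: "\<bar>(\<Sum>i\<in>{1..n}. w n i) / real n - L\<bar> < r" if n: "1 \<le> n" "real n > 2 * C / r" for n
  proof -
    \<comment> \<open>Rows where \<open>v\<close> is not yet within r/2 of its limit, or which are
      too close to an end. At most N + 1 + m of them lie at the start and 2m at the end, each
      costing at most \<open>B + \<bar>L\<bar>\<close>; hence the constant \<open>C\<close>.\<close>
    let ?bad = "{1..N + 1 + m} \<union> {n - 2 * m<..n}"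
    have pt: "\<bar>w n i - L\<bar> \<le> r / 2 + (B + \<bar>L\<bar>) * of_bool (i \<in> ?bad)" if i: "i \<in> {1..n}" for i
    proof (cases "i \<in> ?bad")
      case True
      then show ?thesis using bound[OF n(1) i] r by simp
    next
      case False
      then have p: "N + 1 + m < i" "i + 2 * m \<le> n" using i by auto
      have "w n (i - m + m) = v (i - m)"
        using p by (intro interior) auto
      then have "\<bar>w n i - L\<bar> < r / 2" using N[of "i - m"] p by simp
      moreover have "of_bool (i \<in> ?bad) = (0::real)" by (simp only: False of_bool_eq)
      ultimately show ?thesis by (simp only: mult_zero_right add_0_right less_imp_le)
    qed
    have "\<bar>(\<Sum>i\<in>{1..n}. w n i) - real n * L\<bar> = \<bar>\<Sum>i\<in>{1..n}. w n i - L\<bar>"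
      by (simp add: sum_subtractf)
    also have "\<dots> \<le> (\<Sum>i\<in>{1..n}. r / 2 + (B + \<bar>L\<bar>) * of_bool (i \<in> ?bad))"
      by (rule order_trans[OF sum_abs]) (intro sum_mono pt)
    also have "\<dots> = real n * (r / 2) + (B + \<bar>L\<bar>) * real (card ({1..n} \<inter> ?bad))"
    proof -
      have "(\<Sum>i\<in>{1..n}. of_bool (i \<in> ?bad)) = real (card ({1..n} \<inter> ?bad))"
        by (rule sum_of_bool_eq[of "{1..n}" "\<lambda>i. i \<in> ?bad", unfolded Collect_mem_eq]) simp_all
      then show ?thesis by (simp only: sum.distrib sum_distrib_left[symmetric]) simp
    qed
    also have "\<dots> \<le> real n * (r / 2) + (B + \<bar>L\<bar>) * real (N + 1 + 3 * m)"
    proof -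
      have "card ({1..n} \<inter> ?bad) \<le> card ?bad" by (intro card_mono) auto
      also have "\<dots> \<le> card {1..N + 1 + m} + card {n - 2 * m<..n}" by (rule card_Un_le)
      also have "\<dots> \<le> N + 1 + 3 * m" by simp
      finally show ?thesis using B0 by (intro add_left_mono mult_left_mono) auto
    qed
    also have "\<dots> = real n * (r / 2) + C" by (simp add: C_def)
    also have "\<dots> < real n * r" using n r by (simp add: field_simps)
    finally have "\<bar>(\<Sum>i\<in>{1..n}. w n i) - real n * L\<bar> / real n < r"
      using n by (simp add: divide_less_eq mult.commute)
    moreover have "(\<Sum>i\<in>{1..n}. w n i) / real n - L = ((\<Sum>i\<in>{1..n}. w n i) - real n * L) / real n"
      using n by (simp add: field_simps)
    ultimately show ?thesis by (simp add: abs_divide)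
  qed
  show "\<exists>n0. \<forall>n\<ge>n0. norm ((\<Sum>i\<in>{1..n}. w n i) / real n - L) < r"
  proof (intro exI allI impI)
    fix n assume "max 1 (nat \<lceil>2 * C / r\<rceil> + 1) \<le> n"
    then have "1 \<le> n" "real n > 2 * C / r" by linarith+
    then show "norm ((\<Sum>i\<in>{1..n}. w n i) / real n - L) < r" using main by simp
  qed
qed

section \<open>The descent count as a sum over starting rows and gaps\<close>

text \<open>Injectivity of \<open>z\<close> is not assumed: tied values share a rank, so strict
  order is preserved and reflected in any case. Descents of ranks can thus be read off from the
  values at every outcome.\<close>

lemma rank_perm_less_iff:
  assumes "i \<in> {1..n}" "j \<in> {1..n}"
  shows "rank_perm n z i < rank_perm n z j \<longleftrightarrow> z i < z j"
proof
  assume "rank_perm n z i < rank_perm n z j"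
  moreover have "rank_perm n z j \<le> rank_perm n z i" if "z j \<le> z i"
    using assms that by (auto simp: rank_perm_def intro!: card_mono)
  ultimately show "z i < z j" by (meson not_le)
next
  assume less: "z i < z j"
  have "{k \<in> {1..n}. z k \<le> z i} \<subset> {k \<in> {1..n}. z k \<le> z j}"
  proof (rule psubsetI)
    have "j \<in> {k \<in> {1..n}. z k \<le> z j}" "j \<notin> {k \<in> {1..n}. z k \<le> z i}"
      using assms less by auto
    then show "{k \<in> {1..n}. z k \<le> z i} \<noteq> {k \<in> {1..n}. z k \<le> z j}" by blast
  qed (use less in auto)
  then show "rank_perm n z i < rank_perm n z j"
    using assms by (simp add: rank_perm_def psubset_card_mono)
qed

definition gaps :: "nat \<Rightarrow> nat \<Rightarrow> nat \<Rightarrow> nat set" where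
  "gaps n m i = {k \<in> {1..m}. i + k \<le> n}"

lemma finite_gaps[simp]: "finite (gaps n m i)"
  by (simp add: gaps_def)

lemma card_gaps_le: "card (gaps n m i) \<le> m"
proof -
  have "card (gaps n m i) \<le> card {1..m}" by (rule card_mono) (auto simp: gaps_def)
  then show ?thesis by simp
qed

text \<open>Reindexing by start and gap, \<open>j = i + k\<close>, removes the truncated subtraction
  from the count.\<close>

lemma m_descents_rank_perm:
  "real (m_descents n m (rank_perm n z)) = (\<Sum>i=1..n. \<Sum>k\<in>gaps n m i. desc z i (i + k))"
proof -
  have bij: "bij_betw (\<lambda>(i, k). (i, i + k)) (SIGMA i:{1..n}. {k \<in> gaps n m i. z (i + k) < z i})
     {(i, j). i \<in> {1..n} \<and> j \<in> {1..n} \<and> 1 \<le> j - i \<and> j - i \<le> m \<and> rank_perm n z i > rank_perm n z j}"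
    (is "bij_betw ?f ?A ?B")
  proof (rule bij_betw_imageI)
    show "inj_on ?f ?A" by (auto simp: inj_on_def)
    show "?f ` ?A = ?B"
    proof (intro equalityI subsetI)
      fix p assume "p \<in> ?f ` ?A"
      then obtain i k where "p = (i, i + k)" "i \<in> {1..n}" "i + k \<in> {1..n}" "1 \<le> k" "k \<le> m" "z (i + k) < z i"
        by (auto simp: gaps_def)
      then show "p \<in> ?B" using rank_perm_less_iff[of "i + k" n i z] by simp
    next
      fix p assume "p \<in> ?B"
      then obtain i j where p: "p = (i, j)" "i \<in> {1..n}" "j \<in> {1..n}" "1 \<le> j - i" "j - i \<le> m"
        "rank_perm n z j < rank_perm n z i" by blast
      then have "z j < z i" using rank_perm_less_iff[of j n i z] by simp
      with p have "p = ?f (i, j - i)" "(i, j - i) \<in> ?A" by (auto simp: gaps_def)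
      then show "p \<in> ?f ` ?A" by blast
    qed
  qed
  have "m_descents n m (rank_perm n z) = card (SIGMA i:{1..n}. {k \<in> gaps n m i. z (i + k) < z i})"
    unfolding m_descents_def by (rule bij_betw_same_card[OF bij, symmetric])
  also have "\<dots> = (\<Sum>i=1..n. card {k \<in> gaps n m i. z (i + k) < z i})"
    by (subst card_SigmaI) auto
  finally show ?thesis
    by (simp add: desc_def Collect_conj_eq)
qed

text \<open>i/(2i+k) = 1/2 - k/(2(2i+k)). The assumption \<open>m \<le> n\<close> makes the
  subtraction \<open>n - k\<close> exact for all gaps.\<close>

lemma sum_gaps:
  assumes "m \<le> n"
  shows "(\<Sum>i=1..n. \<Sum>k\<in>gaps n m i. real i / (real i + real (i + k)))
     = real n * real m / 2 - real m * (real m + 1) / 4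
       - (\<Sum>k=1..m. \<Sum>i=1..n-k. real k / (2 * (2 * real i + real k)))"
proof -
  have "(\<Sum>i=1..n. \<Sum>k\<in>gaps n m i. real i / (real i + real (i + k)))
      = (\<Sum>k=1..m. \<Sum>i\<in>{i\<in>{1..n}. i + k \<le> n}. real i / (real i + real (i + k)))"
    unfolding gaps_def by (rule sum.swap_restrict) auto
  also have "\<dots> = (\<Sum>k=1..m. \<Sum>i=1..n-k. 1 / 2 - real k / (2 * (2 * real i + real k)))"
    by (intro sum.cong) (auto simp: field_simps)
  also have "\<dots> = (\<Sum>k=1..m. real (n - k) / 2)
      - (\<Sum>k=1..m. \<Sum>i=1..n-k. real k / (2 * (2 * real i + real k)))"
    by (simp add: sum_subtractf)
  also have "(\<Sum>k=1..m. real (n - k) / 2) = (\<Sum>k=1..m. real n / 2 - real k / 2)"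
    using assms by (intro sum.cong) (auto simp: of_nat_diff field_simps)
  also have "\<dots> = real n * real m / 2 - real m * (real m + 1) / 4"
  proof -
    have "(\<Sum>k=1..m. real k) = real m * (real m + 1) / 2"
      by (induction m) (simp_all add: field_simps)
    then show ?thesis by (simp add: sum_subtractf sum_divide_distrib[symmetric] field_simps)
  qed
  finally show ?thesis .
qed

section \<open>Exact moments of descents for independent power-law variables\<close>

text \<open>This retains the two facts about the row maxima on which the moments and the normal
  approximation rest: independence, and the row index as exponent.\<close>

locale power_laws = prob_space M for M :: "'a measure" +
  fixes n :: nat and Z :: "nat \<Rightarrow> 'a \<Rightarrow> real"
  assumes indep: "indep_vars (\<lambda>_. borel) Z {1..n}"
    and law: "\<And>i. i \<in> {1..n} \<Longrightarrow> power_law i (Z i)"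
begin

abbreviation zs :: "'a \<Rightarrow> nat \<Rightarrow> real" where "zs \<omega> i \<equiv> Z i \<omega>"

lemma Z_measurable: "i \<in> {1..n} \<Longrightarrow> random_variable borel (Z i)"
  using law by (simp add: power_law_def)

lemma desc_measurable:
  assumes "a \<in> {1..n}" "b \<in> {1..n}"
  shows "random_variable borel (\<lambda>\<omega>. desc (zs \<omega>) a b)"
proof -
  note [measurable] = Z_measurable[OF assms(1)] Z_measurable[OF assms(2)]
  show ?thesis unfolding desc_def by measurable
qed

lemma desc_integrable:
  assumes "a \<in> {1..n}" "b \<in> {1..n}"
  shows "integrable M (\<lambda>\<omega>. desc (zs \<omega>) a b)"
  using desc_measurable[OF assms] by (intro integrable_bounded[where c=1]) (auto simp: desc_def)

lemma desc_prod_integrable: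
  assumes "a \<in> {1..n}" "b \<in> {1..n}" "c \<in> {1..n}" "d \<in> {1..n}"
  shows "integrable M (\<lambda>\<omega>. desc (zs \<omega>) a b * desc (zs \<omega>) c d)"
  using desc_measurable[OF assms(1,2)] desc_measurable[OF assms(3,4)]
  by (intro integrable_bounded[where c=1] borel_measurable_times) (auto simp: desc_def)

lemma expectation_of_bool: "expectation (\<lambda>\<omega>. of_bool (P \<omega>)) = prob {\<omega> \<in> space M. P \<omega>}"
proof -
  have "expectation (\<lambda>\<omega>. of_bool (P \<omega>)) = expectation (indicat_real {\<omega> \<in> space M. P \<omega>})"
    by (intro Bochner_Integration.integral_cong) auto
  moreover have "{\<omega> \<in> space M. P \<omega>} \<inter> space M = {\<omega> \<in> space M. P \<omega>}" by auto
  ultimately show ?thesis by simp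
qed

lemma indep_Z:
  assumes "a \<in> {1..n}" "b \<in> {1..n}" "a \<noteq> b"
  shows "indep_var borel (Z a) borel (Z b)"
  using indep_var_disjoint[OF indep, of "{a}" "{b}" "\<lambda>z. z a" "\<lambda>z. z b"] assms by auto

lemma expectation_desc:
  assumes "a \<in> {1..n}" "b \<in> {1..n}" "a \<noteq> b"
  shows "expectation (\<lambda>\<omega>. desc (zs \<omega>) a b) = real a / (real a + real b)"
  using power_law_prob_less[OF law law _ _ indep_Z, of b a] assms
  by (simp add: desc_def expectation_of_bool add.commute)

text \<open>Both descents occur exactly when \<open>Z a\<close> exceeds the maximum of
  \<open>Z b\<close> and \<open>Z d\<close>, which is independent of it and has exponent
  \<open>b + d\<close>.\<close>

lemma expectation_desc_same_start:
  assumes "a \<in> {1..n}" "b \<in> {1..n}" "d \<in> {1..n}" "a \<noteq> b" "a \<noteq> d" "b \<noteq> d"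
  shows "expectation (\<lambda>\<omega>. desc (zs \<omega>) a b * desc (zs \<omega>) a d) = real a / real (a + b + d)"
proof -
  have "indep_var borel (\<lambda>\<omega>. max (Z b \<omega>) (Z d \<omega>)) borel (Z a)"
    using indep_var_disjoint[OF indep, of "{b, d}" "{a}" "\<lambda>z. max (z b) (z d)" "\<lambda>z. z a"] assms by auto
  moreover have "power_law (b + d) (\<lambda>\<omega>. max (Z b \<omega>) (Z d \<omega>))"
    using assms by (intro power_law_max law indep_Z)
  ultimately have "prob {\<omega> \<in> space M. max (Z b \<omega>) (Z d \<omega>) < Z a \<omega>} = real a / (real (b + d) + real a)"
    using assms by (intro power_law_prob_less law) auto
  then show ?thesis
    by (simp add: desc_def expectation_of_bool add_ac flip: of_bool_conj)
qed

text \<open>The two opposite indicators never sum to more than 1, while their expectations sum to 1.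
  A nonnegative variable with integral 0 vanishes almost everywhere, so ties are null.\<close>

lemma desc_swap_AE:
  assumes "a \<in> {1..n}" "b \<in> {1..n}" "a \<noteq> b"
  shows "AE \<omega> in M. desc (zs \<omega>) a b = 1 - desc (zs \<omega>) b a"
proof -
  note [measurable] = Z_measurable[OF assms(1)] Z_measurable[OF assms(2)]
  have "expectation (\<lambda>\<omega>. 1 - desc (zs \<omega>) b a - desc (zs \<omega>) a b) = 0"
    using assms desc_integrable[of a b] desc_integrable[of b a]
    by (simp add: expectation_desc prob_space add.commute[of "real b"])
      (simp add: divide_simps)
  then have "AE \<omega> in M. 1 - desc (zs \<omega>) b a - desc (zs \<omega>) a b = 0"
    using assms desc_integrable[of a b] desc_integrable[of b a]
    by (subst (asm) integral_nonneg_eq_0_iff_AE) (auto simp: desc_def)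
  then show ?thesis by eventually_elim simp
qed

text \<open>Reversing one or both descents moves a shared index to the start of both, which reduces
  every overlapping pattern of two distinct descents to the common-start formula. The orientations
  \<open>a < b\<close> and \<open>c < d\<close> ensure that in the chain patterns the three indices
  are distinct.\<close>

lemma covariance_desc:
  assumes "a \<in> {1..n}" "b \<in> {1..n}" "c \<in> {1..n}" "d \<in> {1..n}" "a < b" "c < d"
  shows "expectation (\<lambda>\<omega>. (desc (zs \<omega>) a b - a / (a + b)) * (desc (zs \<omega>) c d - c / (c + d)))
       = desc_cov a b c d"
proof -
  let ?I = "\<lambda>a b \<omega>. desc (zs \<omega>) a b"
  note ints = desc_integrable desc_prod_integrable
  have cov: "expectation (\<lambda>\<omega>. (?I a b \<omega> - a / (a + b)) * (?I c d \<omega> - c / (c + d)))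
    = expectation (\<lambda>\<omega>. ?I a b \<omega> * ?I c d \<omega>) - a / (a + b) * (c / (c + d))"
  proof -
    have "(?I a b \<omega> - a / (a + b)) * (?I c d \<omega> - c / (c + d))
      = ?I a b \<omega> * ?I c d \<omega> - ?I a b \<omega> * (c / (c + d)) - (a / (a + b)) * ?I c d \<omega> + a / (a + b) * (c / (c + d))" for \<omega>
      by (simp add: algebra_simps)
    then show ?thesis
      using assms ints[of a b] ints[of c d] desc_prod_integrable[of a b c d]
      by (simp add: expectation_desc prob_space)
  qed
  \<comment> \<open>The chain through \<open>y\<close>: the first descent is reversed so that both
    start at \<open>y\<close>.\<close>
  have swap1: "expectation (\<lambda>\<omega>. ?I x y \<omega> * ?I y w \<omega>) = y / (y + w) - y / (y + x + w)"
    if "x \<in> {1..n}" "y \<in> {1..n}" "w \<in> {1..n}" "x \<noteq> y" "y \<noteq> w" "x \<noteq> w" for x y w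
  proof -
    have "expectation (\<lambda>\<omega>. ?I x y \<omega> * ?I y w \<omega>) = expectation (\<lambda>\<omega>. ?I y w \<omega> - ?I y x \<omega> * ?I y w \<omega>)"
    proof (rule integral_cong_AE)
      show "AE \<omega> in M. ?I x y \<omega> * ?I y w \<omega> = ?I y w \<omega> - ?I y x \<omega> * ?I y w \<omega>"
        using desc_swap_AE[OF that(1,2,4)] by eventually_elim (simp only: left_diff_distrib mult_1_left)
    qed (use that in \<open>auto intro!: borel_measurable_times borel_measurable_diff desc_measurable\<close>)
    also have "\<dots> = y / (y + w) - y / (y + x + w)"
      using that by (simp add: ints expectation_desc expectation_desc_same_start)
    finally show ?thesis by simp
  qed
  consider "a = c" "b = d" | "a = c" "b \<noteq> d" | "a \<noteq> c" "b = d" | "b = c" | "a = d"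
    | "a \<noteq> c" "b \<noteq> d" "b \<noteq> c" "a \<noteq> d" by blast
  then show ?thesis
  proof cases
    case 1
    have "expectation (\<lambda>\<omega>. ?I a b \<omega> * ?I a b \<omega>) = expectation (?I a b)"
      by (intro Bochner_Integration.integral_cong) (auto simp: desc_def)
    then show ?thesis using 1 cov assms by (simp add: desc_cov_def expectation_desc)
  next
    case 2
    then show ?thesis using cov assms by (simp add: desc_cov_def expectation_desc_same_start)
  next
    case 3
    have "expectation (\<lambda>\<omega>. ?I a b \<omega> * ?I c b \<omega>)
        = expectation (\<lambda>\<omega>. 1 - ?I b a \<omega> - ?I b c \<omega> + ?I b a \<omega> * ?I b c \<omega>)"
    proof (rule integral_cong_AE)
      have "AE \<omega> in M. ?I a b \<omega> = 1 - ?I b a \<omega>" using 3 assms by (intro desc_swap_AE) auto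
      moreover have "AE \<omega> in M. ?I c b \<omega> = 1 - ?I b c \<omega>" using 3 assms by (intro desc_swap_AE) auto
      ultimately show "AE \<omega> in M. ?I a b \<omega> * ?I c b \<omega> = 1 - ?I b a \<omega> - ?I b c \<omega> + ?I b a \<omega> * ?I b c \<omega>"
        by eventually_elim (simp only:, simp add: algebra_simps)
    qed (use assms in \<open>auto intro!: borel_measurable_times borel_measurable_diff borel_measurable_add desc_measurable\<close>)
    also have "\<dots> = 1 - b / (b + a) - b / (b + c) + b / (b + a + c)"
      using 3 assms by (simp add: ints expectation_desc expectation_desc_same_start prob_space)
    finally show ?thesis using 3 cov assms by (simp add: desc_cov_def)
  next
    case 4
    then show ?thesis using cov assms swap1[of a b d] by (simp add: desc_cov_def)
  next
    case 5
    then show ?thesis using cov assms swap1[of c a b] by (simp add: desc_cov_def mult.commute)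
  next
    case 6
    have "indep_var borel (?I a b) borel (?I c d)"
    proof -
      have m: "(\<lambda>z. desc z x y) \<in> borel_measurable (PiM {x, y} (\<lambda>_. borel))" for x y
        unfolding desc_def by measurable
      show ?thesis
        using assms 6 by (intro indep_var_disjoint[OF indep, of "{a, b}" "{c, d}"] m) (auto simp: desc_def)
    qed
    then have "expectation (\<lambda>\<omega>. ?I a b \<omega> * ?I c d \<omega>) = expectation (?I a b) * expectation (?I c d)"
      using assms by (intro indep_var_lebesgue_integral ints) auto
    then show ?thesis using cov assms 6 by (simp add: desc_cov_def expectation_desc)
  qed
qed

end

subsection \<open>Decomposition of the descent count into rows\<close>

text \<open>The centred number of counted descents that start at row \<open>i\<close>. It depends
  only on the values of \<open>z\<close> from \<open>i\<close> to
  \<open>min n (i + m)\<close>.\<close>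

definition row_dev :: "nat \<Rightarrow> nat \<Rightarrow> (nat \<Rightarrow> real) \<Rightarrow> nat \<Rightarrow> real" where
  "row_dev n m z i = (\<Sum>k\<in>gaps n m i. desc z i (i + k) - real i / (real i + real (i + k)))"

definition near :: "nat \<Rightarrow> nat \<Rightarrow> nat \<Rightarrow> nat set" where
  "near n r i = {j \<in> {1..n}. j \<le> i + r \<and> i \<le> j + r}"

lemma card_near_le: "card (near n r i) \<le> 2 * r + 1"
proof -
  have "card (near n r i) \<le> card {i - r..i + r}" by (rule card_mono) (auto simp: near_def)
  also have "\<dots> \<le> 2 * r + 1" by simp
  finally show ?thesis .
qed

text \<open>Together with the measurability below, this certifies the locality of a row in the form
  that the independence of functions of disjoint blocks requires.\<close>

lemma row_dev_restrict:
  assumes "i \<in> {1..n}" "{i..min n (i + m)} \<subseteq> J"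
  shows "row_dev n m (restrict z J) i = row_dev n m z i"
proof -
  have "i \<in> J" "\<And>k. k \<in> gaps n m i \<Longrightarrow> i + k \<in> J" using assms by (auto simp: gaps_def)
  then show ?thesis unfolding row_dev_def by (intro sum.cong) (auto simp: desc_def)
qed

lemma row_dev_measurable:
  assumes "i \<in> {1..n}" "{i..min n (i + m)} \<subseteq> J"
  shows "(\<lambda>z. row_dev n m z i) \<in> borel_measurable (PiM J (\<lambda>_. borel))"
proof -
  have J: "i \<in> J" "\<And>k. k \<in> gaps n m i \<Longrightarrow> i + k \<in> J" using assms by (auto simp: gaps_def)
  have "(\<lambda>z. desc z i (i + k) - real i / (real i + real (i + k))) \<in> borel_measurable (PiM J (\<lambda>_. borel))"
    if "k \<in> gaps n m i" for k
    using J(1) J(2)[OF that] unfolding desc_def by measurable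
  then show ?thesis unfolding row_dev_def by (rule borel_measurable_sum)
qed

lemma abs_desc_dev_le: "\<bar>desc z a b - real a / (real a + real b)\<bar> \<le> 1"
proof -
  have "0 \<le> real a / (real a + real b)" "real a / (real a + real b) \<le> 1"
    by (auto simp: divide_le_eq_1)
  then show ?thesis by (auto simp: desc_def)
qed

lemma abs_row_dev_le: "\<bar>row_dev n m z i\<bar> \<le> real m"
proof -
  have "\<bar>row_dev n m z i\<bar> \<le> real (card (gaps n m i)) * 1"
    unfolding row_dev_def by (intro order_trans[OF sum_abs] sum_bounded_above abs_desc_dev_le)
  then show ?thesis using card_gaps_le[of n m i] by linarith
qed

text \<open>The share of row \<open>i\<close> in the variance: its covariance with all rows at
  distance at most \<open>m\<close>, written as an explicit rational expression so that limits can
  be taken.\<close>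

definition site_cov :: "nat \<Rightarrow> nat \<Rightarrow> nat \<Rightarrow> real" where
  "site_cov n m i = (\<Sum>j\<in>near n m i. \<Sum>k\<in>gaps n m i. \<Sum>l\<in>gaps n m j. desc_cov i (i + k) j (j + l))"

text \<open>Away from both ends nothing is cut off: all rows from \<open>p\<close> to
  \<open>p + 2 * m\<close> exist and have their full set of \<open>m\<close> partners, so the
  expression no longer involves \<open>n\<close>.\<close>

lemma site_cov_interior:
  assumes "1 \<le> p" "p + 3 * m \<le> n"
  shows "site_cov n m (p + m)
    = (\<Sum>e\<le>2 * m. \<Sum>k=1..m. \<Sum>l=1..m. desc_cov (p + m) (p + m + k) (p + e) (p + e + l))"
proof -
  have near: "near n m (p + m) = (\<lambda>e. p + e) ` {..2 * m}"
  proof (intro equalityI subsetI)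
    fix j assume "j \<in> near n m (p + m)"
    then have "j = p + (j - p)" "j - p \<in> {..2 * m}" by (auto simp: near_def)
    then show "j \<in> (\<lambda>e. p + e) ` {..2 * m}" by blast
  qed (use assms in \<open>auto simp: near_def\<close>)
  have gaps: "gaps n m (p + e) = {1..m}" if "e \<le> 2 * m" for e
    using that assms by (auto simp: gaps_def)
  show ?thesis
    unfolding site_cov_def near by (subst sum.reindex) (auto simp: gaps intro!: sum.cong)
qed

lemma site_cov_limit:
  "(\<lambda>p. \<Sum>e\<le>2 * m. \<Sum>k=1..m. \<Sum>l=1..m. desc_cov (p + m) (p + m + k) (p + e) (p + e + l))
     \<longlonglongrightarrow> real m / 12"
  unfolding desc_cov_limit_sum[symmetric]
  by (intro tendsto_sum desc_cov_limit) auto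

context power_laws
begin

lemma row_dev_random_variable:
  assumes "i \<in> {1..n}"
  shows "random_variable borel (\<lambda>\<omega>. row_dev n m (zs \<omega>) i)"
  unfolding row_dev_def
  using assms by (intro borel_measurable_sum borel_measurable_diff borel_measurable_const desc_measurable)
    (auto simp: gaps_def)

lemma row_dev_integrable:
  assumes "i \<in> {1..n}"
  shows "integrable M (\<lambda>\<omega>. row_dev n m (zs \<omega>) i)"
  using row_dev_random_variable[OF assms] abs_row_dev_le
  by (intro integrable_bounded[where c="real m"]) auto

lemma expectation_row_dev:
  assumes "i \<in> {1..n}"
  shows "expectation (\<lambda>\<omega>. row_dev n m (zs \<omega>) i) = 0"
proof -
  have "expectation (\<lambda>\<omega>. desc (zs \<omega>) i (i + k) - real i / (real i + real (i + k))) = 0"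
    if "k \<in> gaps n m i" for k
    using assms that desc_integrable[of i "i + k"]
    by (simp add: gaps_def expectation_desc prob_space)
  moreover have "integrable M (\<lambda>\<omega>. desc (zs \<omega>) i (i + k) - real i / (real i + real (i + k)))"
    if "k \<in> gaps n m i" for k
    using assms that by (intro Bochner_Integration.integrable_diff desc_integrable) (auto simp: gaps_def)
  ultimately show ?thesis unfolding row_dev_def by (simp add: Bochner_Integration.integral_sum)
qed

lemma expectation_row_dev_near:
  assumes i: "i \<in> {1..n}"
  shows "expectation (\<lambda>\<omega>. row_dev n m (zs \<omega>) i * (\<Sum>j\<in>near n m i. row_dev n m (zs \<omega>) j)) = site_cov n m i"
proof -
  let ?d = "\<lambda>\<omega> i k. desc (zs \<omega>) i (i + k) - real i / (real i + real (i + k))"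
  have int: "integrable M (\<lambda>\<omega>. ?d \<omega> i k * ?d \<omega> j l)"
    if "j \<in> near n m i" "k \<in> gaps n m i" "l \<in> gaps n m j" for j k l
  proof (intro integrable_bounded[where c=1])
    have r: "i \<in> {1..n}" "i + k \<in> {1..n}" "j \<in> {1..n}" "j + l \<in> {1..n}"
      using that i by (auto simp: near_def gaps_def)
    show "random_variable borel (\<lambda>\<omega>. ?d \<omega> i k * ?d \<omega> j l)"
      using r by (intro borel_measurable_times borel_measurable_diff borel_measurable_const desc_measurable)
    show "norm (?d \<omega> i k * ?d \<omega> j l) \<le> 1" for \<omega>
      unfolding real_norm_def abs_mult
      by (rule mult_le_one[OF abs_desc_dev_le abs_ge_zero abs_desc_dev_le])
  qed
  have "row_dev n m (zs \<omega>) i * (\<Sum>j\<in>near n m i. row_dev n m (zs \<omega>) j)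
     = (\<Sum>j\<in>near n m i. \<Sum>k\<in>gaps n m i. \<Sum>l\<in>gaps n m j. ?d \<omega> i k * ?d \<omega> j l)" for \<omega>
    unfolding row_dev_def by (subst sum_distrib_left) (intro sum.cong[OF refl] sum_product)
  then have "expectation (\<lambda>\<omega>. row_dev n m (zs \<omega>) i * (\<Sum>j\<in>near n m i. row_dev n m (zs \<omega>) j))
     = (\<Sum>j\<in>near n m i. \<Sum>k\<in>gaps n m i. \<Sum>l\<in>gaps n m j. expectation (\<lambda>\<omega>. ?d \<omega> i k * ?d \<omega> j l))"
    using int by (simp only: Bochner_Integration.integral_sum Bochner_Integration.integrable_sum cong: sum.cong)
  also have "\<dots> = site_cov n m i"
    unfolding site_cov_def
    using i by (intro sum.cong refl covariance_desc) (auto simp: near_def gaps_def)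
  finally show ?thesis .
qed

text \<open>The bound comes from the probabilistic meaning, a product of row deviations of size at
  most \<open>m\<close> with at most 2m + 1 neighbours, rather than from the rational
  formula.\<close>

lemma abs_site_cov_le:
  assumes i: "i \<in> {1..n}"
  shows "\<bar>site_cov n m i\<bar> \<le> real m * (real (2 * m + 1) * real m)"
proof -
  let ?g = "\<lambda>\<omega>. row_dev n m (zs \<omega>) i * (\<Sum>j\<in>near n m i. row_dev n m (zs \<omega>) j)"
  have b: "norm (?g \<omega>) \<le> real m * (real (2 * m + 1) * real m)" for \<omega>
  proof -
    have "\<bar>\<Sum>j\<in>near n m i. row_dev n m (zs \<omega>) j\<bar> \<le> real (card (near n m i)) * real m"
      by (intro order_trans[OF sum_abs] sum_bounded_above abs_row_dev_le)
    also have "\<dots> \<le> real (2 * m + 1) * real m"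
      using card_near_le[of n m i] by (intro mult_right_mono) (simp_all only: of_nat_le_iff of_nat_0_le_iff)
    finally show ?thesis
      unfolding real_norm_def abs_mult by (intro mult_mono abs_row_dev_le) auto
  qed
  have "random_variable borel ?g"
    using i by (intro borel_measurable_times borel_measurable_sum row_dev_random_variable) (auto simp: near_def)
  from norm_expectation_le[OF integrable_bounded[OF this b] b] expectation_row_dev_near[OF i]
  show ?thesis by simp
qed

text \<open>The general approximation with neighbourhoods of radius \<open>m\<close> and
  \<open>2 * m\<close>, summands bounded by \<open>m\<close> and at most 4m + 1 of them in the
  larger neighbourhood.\<close>

lemma
  shows variance_row_dev_sum:
      "expectation (\<lambda>\<omega>. (\<Sum>i\<in>{1..n}. row_dev n m (zs \<omega>) i)\<^sup>2) = (\<Sum>i\<in>{1..n}. site_cov n m i)"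
    and char_row_dev_sum:
      "norm (expectation (\<lambda>\<omega>. iexp (t * (\<Sum>i\<in>{1..n}. row_dev n m (zs \<omega>) i)))
         - exp (- of_real ((\<Sum>i\<in>{1..n}. site_cov n m i) * t\<^sup>2 / 2)))
       \<le> real n * (4 * real m ^ 3 * real (4 * m + 1) ^ 2) * \<bar>t\<bar> ^ 3"
proof -
  let ?I = "{1..n}" and ?A = "near n m" and ?B = "near n (2 * m)"
  let ?Y = "\<lambda>i \<omega>. row_dev n m (zs \<omega>) i"
  have AB: "?A i \<subseteq> ?B i" "?B i \<subseteq> ?I" "card (?B i) \<le> 4 * m + 1" for i
    using card_near_le[of n "2 * m" i] by (auto simp: near_def)
  have sum_meas: "(\<lambda>z. \<Sum>j\<in>S. row_dev n m z j) \<in> borel_measurable (PiM J (\<lambda>_. borel))"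
    and sum_restrict: "(\<Sum>j\<in>S. row_dev n m (restrict z J) j) = (\<Sum>j\<in>S. row_dev n m z j)"
    if "\<And>j. j \<in> S \<Longrightarrow> j \<in> {1..n} \<and> {j..min n (j + m)} \<subseteq> J" for S J z
    using that by (auto intro!: borel_measurable_sum row_dev_measurable sum.cong row_dev_restrict)
  have ind1: "indep_var borel (?Y i) borel (\<lambda>\<omega>. \<Sum>j\<in>?I - ?A i. ?Y j \<omega>)" if i: "i \<in> ?I" for i
  proof -
    \<comment> \<open>The positions read by row \<open>i\<close>. A row outside \<open>?A i\<close>
      either starts after \<open>i + m\<close> or has its last partner before
      \<open>i\<close>.\<close>
    let ?J = "{i..min n (i + m)}"
    have *: "j \<in> {1..n} \<and> {j..min n (j + m)} \<subseteq> ?I - ?J" if "j \<in> ?I - ?A i" for j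
      using that i by (auto simp: near_def)
    show ?thesis
    proof (rule indep_var_disjoint[OF indep, where J="?J" and K="?I - ?J" and f="\<lambda>z. row_dev n m z i"
          and g="\<lambda>z. \<Sum>j\<in>?I - ?A i. row_dev n m z j"])
      show "?J \<subseteq> ?I" using i by auto
      show "(\<lambda>z. row_dev n m z i) \<in> borel_measurable (PiM ?J (\<lambda>_. borel))"
        by (rule row_dev_measurable[OF i order_refl])
      show "row_dev n m (restrict z ?J) i = row_dev n m z i" for z
        by (rule row_dev_restrict[OF i order_refl])
      show "(\<lambda>z. \<Sum>j\<in>?I - ?A i. row_dev n m z j) \<in> borel_measurable (PiM (?I - ?J) (\<lambda>_. borel))"
        by (intro sum_meas *)
      show "(\<Sum>j\<in>?I - ?A i. row_dev n m (restrict z (?I - ?J)) j) = (\<Sum>j\<in>?I - ?A i. row_dev n m z j)" for z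
        by (intro sum_restrict *)
    qed auto
  qed
  have ind2: "indep_var borel (\<lambda>\<omega>. ?Y i \<omega> * (\<Sum>j\<in>?A i. ?Y j \<omega>)) borel (\<lambda>\<omega>. \<Sum>j\<in>?I - ?B i. ?Y j \<omega>)"
    if i: "i \<in> ?I" for i
  proof -
    \<comment> \<open>The product reads from the leftmost neighbour, \<open>i - m\<close>, to the
      last partner of the rightmost one, \<open>i + 2 * m\<close>. A row outside \<open>?B i\<close>
      on the left starts before i - 2m, so even its last partner lies before i - m. Truncation in
      \<open>i - m\<close> is harmless after intersection with \<open>?I\<close>.\<close>
    let ?J = "?I \<inter> {i - m..i + 2 * m}"
    have 1: "j \<in> {1..n} \<and> {j..min n (j + m)} \<subseteq> ?I - ?J" if "j \<in> ?I - ?B i" for j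
      using that i by (auto simp: near_def)
    have 2: "j \<in> {1..n} \<and> {j..min n (j + m)} \<subseteq> ?J" if "j \<in> ?A i" for j
      using that i by (auto simp: near_def)
    have 3: "{i..min n (i + m)} \<subseteq> ?J" using i by auto
    show ?thesis
    proof (rule indep_var_disjoint[OF indep, where J="?J" and K="?I - ?J"
          and f="\<lambda>z. row_dev n m z i * (\<Sum>j\<in>?A i. row_dev n m z j)"
          and g="\<lambda>z. \<Sum>j\<in>?I - ?B i. row_dev n m z j"])
      show "(\<lambda>z. row_dev n m z i * (\<Sum>j\<in>?A i. row_dev n m z j)) \<in> borel_measurable (PiM ?J (\<lambda>_. borel))"
        by (intro borel_measurable_times row_dev_measurable[OF i 3] sum_meas 2)
      show "row_dev n m (restrict z ?J) i * (\<Sum>j\<in>?A i. row_dev n m (restrict z ?J) j)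
          = row_dev n m z i * (\<Sum>j\<in>?A i. row_dev n m z j)" for z
        by (intro arg_cong2[where f="(*)"] row_dev_restrict[OF i 3] sum_restrict 2)
      show "(\<lambda>z. \<Sum>j\<in>?I - ?B i. row_dev n m z j) \<in> borel_measurable (PiM (?I - ?J) (\<lambda>_. borel))"
        by (intro sum_meas 1)
      show "(\<Sum>j\<in>?I - ?B i. row_dev n m (restrict z (?I - ?J)) j) = (\<Sum>j\<in>?I - ?B i. row_dev n m z j)" for z
        by (intro sum_restrict 1)
    qed auto
  qed
  note approx = char_locally_dependent_approx[of ?I ?A ?B "4 * m + 1" ?Y "real m",
      OF _ AB(1) AB(2) AB(3) row_dev_random_variable abs_row_dev_le expectation_row_dev ind1 ind2]
  have v: "(\<Sum>i\<in>?I. expectation (\<lambda>\<omega>. ?Y i \<omega> * (\<Sum>j\<in>?A i. ?Y j \<omega>))) = (\<Sum>i\<in>?I. site_cov n m i)"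
    by (intro sum.cong refl expectation_row_dev_near)
  show "expectation (\<lambda>\<omega>. (\<Sum>i\<in>?I. ?Y i \<omega>)\<^sup>2) = (\<Sum>i\<in>?I. site_cov n m i)"
    using approx(1) by (simp only: v finite_atLeastAtMost simp_thms)
  show "norm (expectation (\<lambda>\<omega>. iexp (t * (\<Sum>i\<in>?I. ?Y i \<omega>)))
         - exp (- of_real ((\<Sum>i\<in>?I. site_cov n m i) * t\<^sup>2 / 2)))
       \<le> real n * (4 * real m ^ 3 * real (4 * m + 1) ^ 2) * \<bar>t\<bar> ^ 3"
    using approx(2)[of t] by (simp only: v finite_atLeastAtMost simp_thms card_atLeastAtMost diff_Suc_1)
qed

lemma
  shows expectation_descents: "expectation (\<lambda>\<omega>. \<Sum>i=1..n. \<Sum>k\<in>gaps n m i. desc (zs \<omega>) i (i + k))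
      = (\<Sum>i=1..n. \<Sum>k\<in>gaps n m i. real i / (real i + real (i + k)))" (is "expectation ?D = ?e")
    and descents_minus_expectation:
      "(\<Sum>i=1..n. \<Sum>k\<in>gaps n m i. desc (zs \<omega>) i (i + k))
         - expectation (\<lambda>\<omega>. \<Sum>i=1..n. \<Sum>k\<in>gaps n m i. desc (zs \<omega>) i (i + k))
       = (\<Sum>i\<in>{1..n}. row_dev n m (zs \<omega>) i)"
proof -
  have dev: "(\<Sum>i\<in>{1..n}. row_dev n m (zs \<omega>) i) = ?D \<omega> - ?e" for \<omega>
    unfolding row_dev_def by (simp add: sum_subtractf)
  have "expectation (\<lambda>\<omega>. \<Sum>i\<in>{1..n}. row_dev n m (zs \<omega>) i) = 0"
    using row_dev_integrable by (simp add: Bochner_Integration.integral_sum expectation_row_dev)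
  moreover have "integrable M ?D"
    by (intro Bochner_Integration.integrable_sum desc_integrable) (auto simp: gaps_def)
  ultimately show e: "expectation ?D = ?e"
    unfolding dev by (simp add: prob_space)
  show "?D \<omega> - expectation ?D = (\<Sum>i\<in>{1..n}. row_dev n m (zs \<omega>) i)"
    unfolding dev e ..
qed

end

section \<open>Return to the array and passage to the limit\<close>

text \<open>Rows of the array are disjoint blocks of indices, and each row maximum is a measurable
  function of its own block, so independence passes to the maxima.\<close>

lemma (in unfair_array) power_laws_row_max: "power_laws M n (\<lambda>i \<omega>. row_max X \<omega> i)"
proof unfold_locales
  let ?U = "\<lambda>(i, j). X i j"
  let ?P = "{(i, j). 1 \<le> i \<and> i \<le> n \<and> 1 \<le> j \<and> j \<le> i}"
  have "indep_vars (\<lambda>i. PiM ({i} \<times> {1..i}) (\<lambda>_. borel))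
      (\<lambda>i \<omega>. restrict (\<lambda>p. ?U p \<omega>) ({i} \<times> {1..i})) {1..n}"
    by (rule indep_vars_restrict[OF indep]) (auto simp: disjoint_family_on_def)
  then have "indep_vars (\<lambda>_. borel)
      (\<lambda>i \<omega>. (\<lambda>f. Max ((\<lambda>j. f (i, j)) ` {1..i})) (restrict (\<lambda>p. ?U p \<omega>) ({i} \<times> {1..i}))) {1..n}"
    by (rule indep_vars_compose2) (auto intro!: borel_measurable_Max)
  moreover have "(\<lambda>f. Max ((\<lambda>j. f (i, j)) ` {1..i})) (restrict (\<lambda>p. ?U p \<omega>) ({i} \<times> {1..i})) = row_max X \<omega> i"
    for i \<omega> unfolding row_max_def by (intro arg_cong[where f=Max] image_cong) auto
  ultimately show "indep_vars (\<lambda>_. borel) (\<lambda>i \<omega>. row_max X \<omega> i) {1..n}" by simp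
  fix i assume i: "i \<in> {1..n}"
  have "power_law (card ({i} \<times> {1..i})) (\<lambda>\<omega>. Max ((\<lambda>p. ?U p \<omega>) ` ({i} \<times> {1..i})))"
  proof (rule power_law_Max_uniform)
    show "indep_vars (\<lambda>_. borel) ?U ({i} \<times> {1..i})"
      using i by (intro indep_vars_subset[OF indep]) auto
    show "distr M borel (?U p) = uniform_measure lborel {0<..<1}" if "p \<in> {i} \<times> {1..i}" for p
      using that i uniform by auto
  qed (use i in auto)
  moreover have "(\<lambda>p. ?U p \<omega>) ` ({i} \<times> {1..i}) = (\<lambda>j. X i j \<omega>) ` {1..i}" for \<omega>
    by (force simp: image_iff)
  ultimately show "power_law i (\<lambda>\<omega>. row_max X \<omega> i)"
    by (simp add: row_max_def)
qed

theorem theorem3p3: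
  fixes M :: "nat \<Rightarrow> 'a measure"
    and X :: "nat \<Rightarrow> nat \<Rightarrow> nat \<Rightarrow> 'a \<Rightarrow> real"
    and \<rho> :: "nat \<Rightarrow> 'a \<Rightarrow> nat \<Rightarrow> nat"
    and D :: "nat \<Rightarrow> 'a \<Rightarrow> real"
    and m :: nat
  assumes "m \<ge> 1"
    and "\<And>n. n \<ge> 1 \<Longrightarrow> unfair_array (M n) n (X n)"
    and "\<And>n \<omega>. \<rho> n \<omega> = inverse_unfair_perm n (X n) \<omega>"
    and "\<And>n \<omega>. D n \<omega> = real (m_descents n m (\<rho> n \<omega>))"
  shows "(\<forall>n\<ge>m. prob_space.expectation (M n) (D n) =
            real n * real m / 2 - real m * (real m + 1) / 4
            - (\<Sum>k=1..m. \<Sum>i=1..n-k. real k / (2 * (2 * real i + real k))))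
       \<and> (\<lambda>n. prob_space.variance (M n) (D n) /
            ((6 * real n * real m + 4 * real m ^ 3 + 3 * real m ^ 2 - real m) / 72)) \<longlonglongrightarrow> 1
       \<and> weak_conv_m
            (\<lambda>n. distr (M n) borel (\<lambda>\<omega>. (D n \<omega> - prob_space.expectation (M n) (D n))
                                        / sqrt (prob_space.variance (M n) (D n))))
            std_normal_distribution"
proof -
  note m = assms(1)
  define Z where "Z n i \<omega> = row_max (X n) \<omega> i" for n i \<omega>
  define E where "E n = prob_space.expectation (M n) (D n)" for n
  define s where "s n = (\<Sum>i\<in>{1..n}. site_cov n m i)" for n
  define N where "N n \<omega> = (D n \<omega> - E n) / sqrt (s n)" for n \<omega>
  define C where "C = 4 * real m ^ 3 * real (4 * m + 1) ^ 2"
  have pl: "power_laws (M n) n (Z n)" if "n \<ge> 1" for n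
    using unfair_array.power_laws_row_max[OF assms(2)[OF that]] by (simp add: Z_def[abs_def])
  have D: "D n = (\<lambda>\<omega>. \<Sum>i=1..n. \<Sum>k\<in>gaps n m i. desc (\<lambda>i. Z n i \<omega>) i (i + k))" for n
    unfolding assms(3,4) inverse_unfair_perm_def m_descents_rank_perm Z_def by simp
  have E: "E n = (\<Sum>i=1..n. \<Sum>k\<in>gaps n m i. real i / (real i + real (i + k)))" if "n \<ge> 1" for n
    unfolding E_def D using power_laws.expectation_descents[OF pl[OF that]] .
  have dev: "D n \<omega> - E n = (\<Sum>i\<in>{1..n}. row_dev n m (\<lambda>i. Z n i \<omega>) i)" if "n \<ge> 1" for n \<omega>
    unfolding E_def D by (rule power_laws.descents_minus_expectation[OF pl[OF that]])
  have V: "prob_space.variance (M n) (D n) = s n" if "n \<ge> 1" for n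
    unfolding E_def[symmetric] dev[OF that] s_def
    by (rule power_laws.variance_row_dev_sum[OF pl[OF that]])

  have "(\<lambda>n. (\<Sum>i\<in>{1..n}. site_cov n m i) / real n) \<longlonglongrightarrow> real m / 12"
    by (rule average_limit[OF power_laws.abs_site_cov_le[OF pl] site_cov_limit site_cov_interior])
  then have s_lim: "(\<lambda>n. s n / real n) \<longlonglongrightarrow> real m / 12" by (simp add: s_def)

  have var: "(\<lambda>n. prob_space.variance (M n) (D n) /
      ((6 * real n * real m + 4 * real m ^ 3 + 3 * real m ^ 2 - real m) / 72)) \<longlonglongrightarrow> 1"
  proof -
    \<comment> \<open>Divided by n, the stated variance tends to 6m/72 = m/12, the limit already
      found for \<open>s n / real n\<close>, so the quotient tends to 1.\<close>
    have "(\<lambda>n. ((6 * real n * real m + 4 * real m ^ 3 + 3 * real m ^ 2 - real m) / 72) / real n) \<longlonglongrightarrow> real m / 12"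
      by real_asymp
    from tendsto_divide[OF s_lim this]
    have "(\<lambda>n. (s n / real n) / (((6 * real n * real m + 4 * real m ^ 3 + 3 * real m ^ 2 - real m) / 72) / real n)) \<longlonglongrightarrow> 1"
      using m by simp
    then show ?thesis
      by (rule Lim_transform_eventually) (use eventually_ge_at_top[of 1] in eventually_elim, simp add: V)
  qed

  have s_pos: "\<forall>\<^sub>F n in sequentially. 1 \<le> n \<and> 0 < s n"
  proof -
    have "\<forall>\<^sub>F n in sequentially. 0 < s n / real n"
      using s_lim m by (intro order_tendstoD) auto
    then show ?thesis
      using eventually_ge_at_top[of 1] by eventually_elim (simp add: zero_less_divide_iff)
  qed

  have N_meas: "N n \<in> borel_measurable (M n)" if "n \<ge> 1" for n
  proof -
    interpret power_laws "M n" n "Z n" by (rule pl[OF that])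
    have "(\<lambda>\<omega>. D n \<omega> - E n) \<in> borel_measurable (M n)"
      unfolding dev[OF that] by (intro borel_measurable_sum row_dev_random_variable)
    then show ?thesis unfolding N_def[abs_def] by simp
  qed

  have char_lim: "(\<lambda>n. char (distr (M n) borel (N n)) t) \<longlonglongrightarrow> char std_normal_distribution t" for t
  proof -
    have "\<forall>\<^sub>F n in sequentially. norm (char (distr (M n) borel (N n)) t - exp (- of_real (t\<^sup>2 / 2)))
        \<le> C * \<bar>t\<bar> ^ 3 * (1 / (s n / real n) * (1 / sqrt (s n / real n)) * (1 / sqrt (real n)))"
      using s_pos
    proof eventually_elim
      case (elim n)
      then have n: "1 \<le> n" and sn: "0 < s n" by auto
      interpret power_laws "M n" n "Z n" by (rule pl[OF n])
      have "char (distr (M n) borel (N n)) t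
          = expectation (\<lambda>\<omega>. iexp (t / sqrt (s n) * (\<Sum>i\<in>{1..n}. row_dev n m (zs \<omega>) i)))"
        unfolding char_def using N_meas[OF n]
        by (subst integral_distr) (simp_all add: N_def dev[OF n])
      moreover have "s n * (t / sqrt (s n))\<^sup>2 = t\<^sup>2"
        using sn by (simp add: power_divide)
      ultimately have "norm (char (distr (M n) borel (N n)) t - exp (- of_real (t\<^sup>2 / 2)))
          \<le> real n * C * \<bar>t / sqrt (s n)\<bar> ^ 3"
        using char_row_dev_sum[of "t / sqrt (s n)" m] by (simp only: s_def[symmetric] C_def)
      also have "\<dots> = C * \<bar>t\<bar> ^ 3 * (real n / (sqrt (s n)) ^ 3)"
        using sn by (simp add: power_divide)
      \<comment> \<open>Split so that the first two factors converge, by the linear growth of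
        \<open>s n\<close>, and the last one supplies the rate n^(-1/2).\<close>
      also have "real n / (sqrt (s n)) ^ 3 = 1 / (s n / real n) * (1 / sqrt (s n / real n)) * (1 / sqrt (real n))"
        using sn n by (simp add: power3_eq_cube real_sqrt_divide)
      finally show ?case .
    qed
    moreover have "(\<lambda>n. C * \<bar>t\<bar> ^ 3 * (1 / (s n / real n) * (1 / sqrt (s n / real n)) * (1 / sqrt (real n)))) \<longlonglongrightarrow> 0"
    proof -
      have root: "(\<lambda>n. 1 / sqrt (real n)) \<longlonglongrightarrow> 0" by real_asymp
      have "(\<lambda>n. 1 / (s n / real n) * (1 / sqrt (s n / real n))) \<longlonglongrightarrow> 1 / (real m / 12) * (1 / sqrt (real m / 12))"
        using m by (intro tendsto_intros s_lim) auto
      from tendsto_mult[OF tendsto_const[of "C * \<bar>t\<bar> ^ 3"] tendsto_mult[OF this root]]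
      show ?thesis by simp
    qed
    ultimately have "(\<lambda>n. char (distr (M n) borel (N n)) t - exp (- of_real (t\<^sup>2 / 2))) \<longlonglongrightarrow> 0"
      by (rule Lim_null_comparison)
    then show ?thesis
      by (simp add: LIM_zero_iff char_std_normal_distribution exp_of_real[symmetric])
  qed

  \<comment> \<open>The space \<open>M 0\<close> is arbitrary, so the continuity theorem is applied to the shifted sequence.\<close>
  have "weak_conv_m (\<lambda>n. distr (M (Suc n)) borel (N (Suc n))) std_normal_distribution"
  proof (rule levy_continuity)
    show "real_distribution (distr (M (Suc n)) borel (N (Suc n)))" for n
    proof -
      interpret power_laws "M (Suc n)" "Suc n" "Z (Suc n)" by (rule pl) simp
      show ?thesis using N_meas[of "Suc n"] by (intro real_distribution_distr) simp
    qed
    show "real_distribution std_normal_distribution" by (rule real_dist_normal_dist)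
    show "(\<lambda>n. char (distr (M (Suc n)) borel (N (Suc n))) t) \<longlonglongrightarrow> char std_normal_distribution t" for t
      using char_lim[of t] by (rule LIMSEQ_Suc)
  qed
  moreover have "N (Suc n) = (\<lambda>\<omega>. (D (Suc n) \<omega> - prob_space.expectation (M (Suc n)) (D (Suc n)))
      / sqrt (prob_space.variance (M (Suc n)) (D (Suc n))))" for n
    using V[of "Suc n"] unfolding N_def[abs_def] E_def by simp
  ultimately have "weak_conv_m (\<lambda>n. distr (M n) borel (\<lambda>\<omega>. (D n \<omega> - prob_space.expectation (M n) (D n))
      / sqrt (prob_space.variance (M n) (D n)))) std_normal_distribution"
    unfolding weak_conv_m_def weak_conv_def by (auto intro: LIMSEQ_imp_Suc)
  moreover have "\<forall>n\<ge>m. prob_space.expectation (M n) (D n) =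
            real n * real m / 2 - real m * (real m + 1) / 4
            - (\<Sum>k=1..m. \<Sum>i=1..n-k. real k / (2 * (2 * real i + real k)))"
    using E m sum_gaps unfolding E_def by simp
  ultimately show ?thesis using var by blast
qed

end
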